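(* Let $\mathfrak A$ and $\mathfrak B$ be two finite-dimensional associative algebras over $\mathbb C$ which are of type 1 and are $1$-precise. Suppose that all roots of the characteristic polynomial of $\mathfrak A$, except the root $1$, depend non-trivially on $F\in\mathfrak A^*$. Then $$\operatorname{ind}(\mathfrak A\otimes\mathfrak B)=\operatorname{ind}\mathfrak A\cdot\operatorname{ind}\mathfrak B .$$
   Context: Let $\mathfrak A$ be a finite-dimensional associative algebra over $\mathbb C$, $F\in\mathfrak A^*$. Let $A_F$ be the matrix $(F(e_ie_j))_{i,j}$ in a basis $\{e_i\}$ of $\mathfrak A$. The characteristic polynomial is $\chi_F(\lambda,\mu)=\det(\lambda A_F+\mu A_F^T)$ (defined up to a nonzero constant multiple depending on the basis). The pair $(\mathfrak A,F)$ is of type 1 if $\chi_F$ is not the zero polynomial in $\lambda,\mu$; $\mathfrak A$ is of type 1 if there is a non-empty open set of functionals $F\in\mathfrak A^*$ (Zariski or Euclidean topology) such that $(\mathfrak A,F)$ is of type 1. For $\alpha\in\mathbb C$, $\mathrm{Stab}_F(\alpha)=\{a\in\mathfrak A: F(ax)=\alpha F(xa)\text{ for all }x\in\mathfrak A\}$. A functional $F$ is $1$-precise if $\dim\mathrm{Stab}_F(1)$ equals exactly the highest power of $\lambda+\mu$ that divides $\chi_F(\lambda,\mu)$. The algebra $\mathfrak A$ is $1$-precise if there is an open dense subset of $\mathfrak A^*$ consisting of $1$-precise functionals. Roots: $\alpha\in\mathbb C\cup\{\infty\}$ is a root of $\chi_F$ if $\chi_F(\lambda,\mu)$ is divisible by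 $\lambda+\mu/\alpha$ (by $\mu$ if $\alpha=0$, by $\lambda$ if $\alpha=\infty$). The roots are regarded as (multivalued algebraic) functions of $F$; that all roots except $1$ depend non-trivially on $F$ means that no constant $\alpha_0\in\mathbb C\cup\{\infty\}$ with $\alpha_0\ne1$ is a root of $\chi_F$ for all $F\in\mathfrak A^*$. A functional $F$ is $1$-regular if $\dim\mathrm{Stab}_F(1)$ is smallest among all functionals in a neighbourhood of $F$ in $\mathfrak A^*$, and $\operatorname{ind}\mathfrak A:=\dim\mathrm{Stab}_F(1)$ for a $1$-regular $F$ (equivalently, the minimum of $\dim\mathrm{Stab}_F(1)$ over $F\in\mathfrak A^*$). $\otimes=\otimes_{\mathbb C}$ is the tensor product of algebras. *)

theory Defs
  imports
    "HOL-Analysis.Function_Topology"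
    "HOL-Library.Poly_Mapping"
    "Jordan_Normal_Form.Determinant"
begin

section \<open>Finite-dimensional complex algebras\<close>

text \<open>The base class \<^class>\<open>ring\<close> is associative but neither commutative nor unital, and it
  allows the zero ring; so no unit is assumed and dimension zero is included.\<close>

class complex_algebra = ring +
  fixes scaleC :: "complex \<Rightarrow> 'a \<Rightarrow> 'a"  (infixr \<open>*\<^sub>C\<close> 75)
  assumes scaleC_add_right: "c *\<^sub>C (x + y) = c *\<^sub>C x + c *\<^sub>C y"
    and scaleC_add_left: "(c + d) *\<^sub>C x = c *\<^sub>C x + d *\<^sub>C x"
    and scaleC_scaleC: "c *\<^sub>C (d *\<^sub>C x) = (c * d) *\<^sub>C x"
    and scaleC_one: "1 *\<^sub>C x = x"
    and mult_scaleC_left: "(c *\<^sub>C x) * y = c *\<^sub>C (x * y)"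
    and mult_scaleC_right: "x * (c *\<^sub>C y) = c *\<^sub>C (x * y)"

class fd_complex_algebra = complex_algebra +
  assumes finite_spanning: "\<exists>B. finite B \<and> (\<forall>x. \<exists>c. x = (\<Sum>b\<in>B. c b *\<^sub>C b))"

global_interpretation cvs: vector_space "scaleC :: complex \<Rightarrow> 'a \<Rightarrow> 'a::complex_algebra"
  by unfold_locales (simp_all add: scaleC_add_right scaleC_add_left scaleC_scaleC scaleC_one)


section \<open>The tensor product of two algebras\<close>

text \<open>The quotient of the free vector space on pairs by the subspace spanned by the bilinearity
  relations. The multiplication is the bilinear extension of
  (a, b) (a', b') = (a a', b b').\<close>

alias single = Poly_Mapping.single
alias lookup = Poly_Mapping.lookup
alias keys = Poly_Mapping.keys

definition fscale :: "complex \<Rightarrow> ('k \<Rightarrow>\<^sub>0 complex) \<Rightarrow> ('k \<Rightarrow>\<^sub>0 complex)" where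
  "fscale c p = Poly_Mapping.map ((*) c) p"

lemma lookup_fscale [simp]: "lookup (fscale c p) k = c * lookup p k"
  by (simp add: fscale_def Poly_Mapping.map.rep_eq when_def)

global_interpretation free_vs: vector_space "fscale :: complex \<Rightarrow> ('k \<Rightarrow>\<^sub>0 complex) \<Rightarrow> _"
  by unfold_locales (auto intro!: poly_mapping_eqI simp: lookup_add algebra_simps)

definition tensor_relators ::
    "('a::complex_algebra \<times> 'b::complex_algebra \<Rightarrow>\<^sub>0 complex) set" where
  "tensor_relators =
     {single (a + a', b) 1 - single (a, b) 1 - single (a', b) 1 | a a' b. True} \<union>
     {single (a, b + b') 1 - single (a, b) 1 - single (a, b') 1 | a b b'. True} \<union>
     {single (c *\<^sub>C a, b) 1 - fscale c (single (a, b) 1) | c a b. True} \<union>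
     {single (a, c *\<^sub>C b) 1 - fscale c (single (a, b) 1) | c a b. True}"

definition tensor_null ::
    "('a::complex_algebra \<times> 'b::complex_algebra \<Rightarrow>\<^sub>0 complex) set" where
  "tensor_null = free_vs.span tensor_relators"

definition tensor_rel ::
    "('a::complex_algebra \<times> 'b::complex_algebra \<Rightarrow>\<^sub>0 complex) \<Rightarrow> ('a \<times> 'b \<Rightarrow>\<^sub>0 complex) \<Rightarrow> bool" where
  "tensor_rel p q \<longleftrightarrow> p - q \<in> tensor_null"

definition fmult ::
    "('a::complex_algebra \<times> 'b::complex_algebra \<Rightarrow>\<^sub>0 complex) \<Rightarrow> ('a \<times> 'b \<Rightarrow>\<^sub>0 complex) \<Rightarrow>
     ('a \<times> 'b \<Rightarrow>\<^sub>0 complex)" where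
  "fmult p q = (\<Sum>x\<in>keys p. \<Sum>y\<in>keys q.
     single (fst x * fst y, snd x * snd y) (lookup p x * lookup q y))"

lemma tensor_null_zero: "0 \<in> tensor_null"
  and tensor_null_add: "p \<in> tensor_null \<Longrightarrow> q \<in> tensor_null \<Longrightarrow> p + q \<in> tensor_null"
  and tensor_null_diff: "p \<in> tensor_null \<Longrightarrow> q \<in> tensor_null \<Longrightarrow> p - q \<in> tensor_null"
  and tensor_null_neg: "p \<in> tensor_null \<Longrightarrow> - p \<in> tensor_null"
  and tensor_null_scale: "p \<in> tensor_null \<Longrightarrow> fscale c p \<in> tensor_null"
  and tensor_null_sum: "(\<And>i. i \<in> I \<Longrightarrow> g i \<in> tensor_null) \<Longrightarrow> sum g I \<in> tensor_null"
  unfolding tensor_null_def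
  by (simp_all add: free_vs.span_zero free_vs.span_add free_vs.span_diff free_vs.span_neg
      free_vs.span_scale free_vs.span_sum)

lemma equivp_tensor_rel: "equivp tensor_rel"
proof (rule equivpI)
  show "reflp tensor_rel"
    by (simp add: reflp_def tensor_rel_def tensor_null_zero)
  show "symp tensor_rel"
    by (metis (no_types, lifting) minus_diff_eq sympI tensor_null_neg tensor_rel_def)
  show "transp tensor_rel"
    using tensor_null_add by (fastforce simp: transp_def tensor_rel_def)
qed

lemma fmult_superset:
  assumes "finite S" "finite T" "keys p \<subseteq> S" "keys q \<subseteq> T"
  shows "fmult p q = (\<Sum>x\<in>S. \<Sum>y\<in>T.
    single (fst x * fst y, snd x * snd y) (lookup p x * lookup q y))"
proof -
  have "fmult p q = (\<Sum>x\<in>keys p. \<Sum>y\<in>T.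
      single (fst x * fst y, snd x * snd y) (lookup p x * lookup q y))"
    unfolding fmult_def
    by (intro sum.cong refl sum.mono_neutral_left) (use assms in \<open>auto simp: in_keys_iff\<close>)
  also have "\<dots> = (\<Sum>x\<in>S. \<Sum>y\<in>T.
      single (fst x * fst y, snd x * snd y) (lookup p x * lookup q y))"
    by (intro sum.mono_neutral_left) (use assms in \<open>auto simp: in_keys_iff\<close>)
  finally show ?thesis .
qed

lemma fscale_single [simp]: "fscale c (single k d) = single k (c * d)"
  by (rule poly_mapping_eqI) (simp add: lookup_single when_def)

lemma fscale_sum: "fscale c (sum g I) = (\<Sum>i\<in>I. fscale c (g i))"
  by (rule free_vs.scale_sum_right)

lemma keys_fscale: "keys (fscale c p) \<subseteq> keys p"
  by (auto simp: in_keys_iff)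

lemma fmult_add_left: "fmult (p + p') q = fmult p q + fmult p' q"
  by (subst (1 2 3) fmult_superset[of "keys p \<union> keys p'" "keys q"])
    (use keys_add[of p p'] in
      \<open>auto simp: lookup_add distrib_right single_add sum.distrib\<close>)

lemma fmult_add_right: "fmult p (q + q') = fmult p q + fmult p q'"
  by (subst (1 2 3) fmult_superset[of "keys p" "keys q \<union> keys q'"])
    (use keys_add[of q q'] in
      \<open>auto simp: lookup_add distrib_left single_add sum.distrib\<close>)

lemma fmult_scale_left: "fmult (fscale c p) q = fscale c (fmult p q)"
  by (subst (1 2) fmult_superset[of "keys p" "keys q"])
    (use keys_fscale[of c p] in \<open>auto simp: fscale_sum mult.assoc\<close>)

lemma fmult_scale_right: "fmult p (fscale c q) = fscale c (fmult p q)"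
  by (subst (1 2) fmult_superset[of "keys p" "keys q"])
    (use keys_fscale[of c q] in \<open>auto simp: fscale_sum mult_ac\<close>)

lemma fmult_zero_left [simp]: "fmult 0 q = 0"
  and fmult_zero_right [simp]: "fmult q 0 = 0"
  by (simp_all add: fmult_def)

lemma fmult_minus_left: "fmult (- p) q = - fmult p q"
  by (rule minus_unique[symmetric]) (simp flip: fmult_add_left)

lemma fmult_minus_right: "fmult p (- q) = - fmult p q"
  by (rule minus_unique[symmetric]) (simp flip: fmult_add_right)

lemma fmult_diff_left: "fmult (p - p') q = fmult p q - fmult p' q"
  using fmult_add_left[of p "- p'" q] by (simp add: fmult_minus_left)

lemma fmult_diff_right: "fmult p (q - q') = fmult p q - fmult p q'"
  using fmult_add_right[of p q "- q'"] by (simp add: fmult_minus_right)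

lemma fmult_sum_left: "fmult (sum g I) q = (\<Sum>i\<in>I. fmult (g i) q)"
  by (induction I rule: infinite_finite_induct) (simp_all add: fmult_add_left)

lemma fmult_sum_right: "fmult p (sum g I) = (\<Sum>i\<in>I. fmult p (g i))"
  by (induction I rule: infinite_finite_induct) (simp_all add: fmult_add_right)

lemma fmult_single:
  "fmult (single x c) (single y d) = single (fst x * fst y, snd x * snd y) (c * d)"
  by (subst fmult_superset[of "{x}" "{y}"]) auto

lemma free_expand: "p = (\<Sum>x\<in>keys p. single x (lookup p x))"
  by (rule poly_mapping_eqI)
    (auto simp: lookup_sum lookup_single when_def in_keys_iff if_distrib cong: if_cong)

lemma fmult_assoc: "fmult (fmult p q) r = fmult p (fmult q r)"
proof -
  have "fmult (fmult (single x c) (single y d)) (single z e) =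
        fmult (single x c) (fmult (single y d) (single z e))"
    for x y z :: "'a \<times> 'b" and c d e
    by (simp add: fmult_single mult.assoc)
  then show ?thesis
    by (subst (1 2) free_expand[of p], subst (1 2) free_expand[of q], subst (1 2) free_expand[of r])
      (simp only: fmult_sum_left fmult_sum_right)
qed

lemma relator_in_null:
  shows "single (a + a', b) e - single (a, b) e - single (a', b) e \<in> tensor_null"
    and "single (a, b + b') e - single (a, b) e - single (a, b') e \<in> tensor_null"
    and "single (c *\<^sub>C a, b) e - single (a, b) (c * e) \<in> tensor_null"
    and "single (a, c *\<^sub>C b) e - single (a, b) (c * e) \<in> tensor_null"
proof -
  have *: "fscale e r \<in> tensor_null" if "r \<in> tensor_relators"
    for r :: "'a \<times> 'b \<Rightarrow>\<^sub>0 complex"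
    using that by (simp add: tensor_null_def free_vs.span_base free_vs.span_scale)
  have "single (a + a', b) 1 - single (a, b) 1 - single (a', b) 1 \<in> tensor_relators"
    unfolding tensor_relators_def by blast
  from *[OF this] show "single (a + a', b) e - single (a, b) e - single (a', b) e \<in> tensor_null"
    by (simp add: free_vs.scale_right_diff_distrib)
  have "single (a, b + b') 1 - single (a, b) 1 - single (a, b') 1 \<in> tensor_relators"
    unfolding tensor_relators_def by blast
  from *[OF this] show "single (a, b + b') e - single (a, b) e - single (a, b') e \<in> tensor_null"
    by (simp add: free_vs.scale_right_diff_distrib)
  have "single (c *\<^sub>C a, b) 1 - fscale c (single (a, b) 1) \<in> tensor_relators"
    unfolding tensor_relators_def by blast
  from *[OF this] show "single (c *\<^sub>C a, b) e - single (a, b) (c * e) \<in> tensor_null"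
    by (simp add: free_vs.scale_right_diff_distrib mult.commute)
  have "single (a, c *\<^sub>C b) 1 - fscale c (single (a, b) 1) \<in> tensor_relators"
    unfolding tensor_relators_def by blast
  from *[OF this] show "single (a, c *\<^sub>C b) e - single (a, b) (c * e) \<in> tensor_null"
    by (simp add: free_vs.scale_right_diff_distrib mult.commute)
qed

lemma fmult_null_left:
  assumes "p \<in> tensor_null"
  shows "fmult p q \<in> tensor_null"
  using assms unfolding tensor_null_def
proof (induction rule: free_vs.span_induct)
  case base
  show ?case
    by (simp add: free_vs.subspace_def fmult_add_left fmult_scale_left
        free_vs.span_zero free_vs.span_add free_vs.span_scale)
next
  case (step r)
  have "fmult r (single y d) \<in> tensor_null" for y d
    using step unfolding tensor_relators_def
    by (cases y) (auto simp: fmult_diff_left fmult_single mult_scaleC_left distrib_right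
        relator_in_null)
  then have "fmult r (\<Sum>x\<in>keys q. single x (lookup q x)) \<in> tensor_null"
    by (simp only: fmult_sum_right tensor_null_sum)
  then show ?case
    by (simp flip: free_expand tensor_null_def)
qed

lemma fmult_null_right:
  assumes "q \<in> tensor_null"
  shows "fmult p q \<in> tensor_null"
  using assms unfolding tensor_null_def
proof (induction rule: free_vs.span_induct)
  case base
  show ?case
    by (simp add: free_vs.subspace_def fmult_add_right fmult_scale_right
        free_vs.span_zero free_vs.span_add free_vs.span_scale)
next
  case (step r)
  have "fmult (single y d) r \<in> tensor_null" for y d
    using step unfolding tensor_relators_def
    by (cases y) (auto simp: fmult_diff_right fmult_single mult_scaleC_right distrib_left
        relator_in_null mult.commute[of d])
  then have "fmult (\<Sum>x\<in>keys p. single x (lookup p x)) r \<in> tensor_null"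
    by (simp only: fmult_sum_left tensor_null_sum)
  then show ?case
    by (simp flip: free_expand tensor_null_def)
qed

quotient_type (overloaded) ('a, 'b) tensor =
  "'a::complex_algebra \<times> 'b::complex_algebra \<Rightarrow>\<^sub>0 complex" / tensor_rel
  by (rule equivp_tensor_rel)

instantiation tensor :: (complex_algebra, complex_algebra) complex_algebra
begin

lift_definition zero_tensor :: "('a, 'b) tensor" is 0 .

lift_definition plus_tensor :: "('a, 'b) tensor \<Rightarrow> ('a, 'b) tensor \<Rightarrow> ('a, 'b) tensor" is "(+)"
  unfolding tensor_rel_def by (metis add_diff_add tensor_null_add)

lift_definition uminus_tensor :: "('a, 'b) tensor \<Rightarrow> ('a, 'b) tensor" is uminus
  unfolding tensor_rel_def by (metis minus_diff_minus tensor_null_neg)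

lift_definition minus_tensor :: "('a, 'b) tensor \<Rightarrow> ('a, 'b) tensor \<Rightarrow> ('a, 'b) tensor" is "(-)"
proof -
  fix p p' q q' :: "'a \<times> 'b \<Rightarrow>\<^sub>0 complex"
  assume "tensor_rel p p'" "tensor_rel q q'"
  then have "(p - p') - (q - q') \<in> tensor_null"
    unfolding tensor_rel_def by (rule tensor_null_diff)
  then show "tensor_rel (p - q) (p' - q')"
    by (simp add: tensor_rel_def algebra_simps)
qed

lift_definition times_tensor :: "('a, 'b) tensor \<Rightarrow> ('a, 'b) tensor \<Rightarrow> ('a, 'b) tensor" is fmult
proof -
  fix p p' q q' :: "'a \<times> 'b \<Rightarrow>\<^sub>0 complex"
  assume "tensor_rel p p'" "tensor_rel q q'"
  then have "fmult (p - p') q + fmult p' (q - q') \<in> tensor_null"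
    unfolding tensor_rel_def by (intro tensor_null_add fmult_null_left fmult_null_right)
  then show "tensor_rel (fmult p q) (fmult p' q')"
    by (simp add: tensor_rel_def fmult_diff_left fmult_diff_right)
qed

lift_definition scaleC_tensor :: "complex \<Rightarrow> ('a, 'b) tensor \<Rightarrow> ('a, 'b) tensor" is fscale
  unfolding tensor_rel_def by (metis free_vs.scale_right_diff_distrib tensor_null_scale)

instance
proof -
  have eq: "tensor_rel p q" if "p = q" for p q :: "'a \<times> 'b \<Rightarrow>\<^sub>0 complex"
    using that by (simp add: tensor_rel_def tensor_null_zero)
  show "OFCLASS(('a, 'b) tensor, complex_algebra_class)"
    by standard
      (transfer, rule eq, simp add: algebra_simps fmult_assoc fmult_add_left fmult_add_right
        free_vs.scale_right_distrib free_vs.scale_left_distrib fmult_scale_left fmult_scale_right)+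
qed

end

lift_definition tens :: "'a::complex_algebra \<Rightarrow> 'b::complex_algebra \<Rightarrow> ('a, 'b) tensor"
  is "\<lambda>a b. single (a, b) 1" .

lemma tens_add_left: "tens (a + a') b = tens a b + tens a' b"
  by transfer (use relator_in_null(1)[of _ _ _ 1] in \<open>simp add: tensor_rel_def diff_diff_eq\<close>)

lemma tens_add_right: "tens a (b + b') = tens a b + tens a b'"
  by transfer (use relator_in_null(2)[of _ _ _ 1] in \<open>simp add: tensor_rel_def diff_diff_eq\<close>)

lemma tens_scaleC_left: "tens (c *\<^sub>C a) b = c *\<^sub>C tens a b"
  by transfer (use relator_in_null(3)[of _ _ _ 1] in \<open>simp add: tensor_rel_def\<close>)

lemma tens_scaleC_right: "tens a (c *\<^sub>C b) = c *\<^sub>C tens a b"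
  by transfer (use relator_in_null(4)[of _ _ _ 1] in \<open>simp add: tensor_rel_def\<close>)

lemma tens_mult: "tens a b * tens a' b' = tens (a * a') (b * b')"
  by transfer (simp add: fmult_single tensor_rel_def tensor_null_zero)


lemma tensor_induct_expand:
  "\<exists>p. T = (\<Sum>x\<in>keys p. lookup p x *\<^sub>C tens (fst x) (snd x))"
proof -
  have "\<exists>p. T = abs_tensor p"
    by (induction T rule: tensor.abs_induct) blast
  then obtain p where T: "T = abs_tensor p" ..
  have single: "abs_tensor (single x c) = c *\<^sub>C tens (fst x) (snd x)"
    for x :: "'a \<times> 'b" and c
    by (simp add: tens.abs_eq scaleC_tensor.abs_eq)
  have add: "abs_tensor (p + q) = abs_tensor p + abs_tensor q"
    for p q :: "'a \<times> 'b \<Rightarrow>\<^sub>0 complex"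
    by (simp add: plus_tensor.abs_eq)
  have sum: "abs_tensor (sum g I) = (\<Sum>i\<in>I. abs_tensor (g i))"
    for g :: "'a \<times> 'b \<Rightarrow> 'a \<times> 'b \<Rightarrow>\<^sub>0 complex" and I
    by (induction I rule: infinite_finite_induct) (simp_all add: add zero_tensor.abs_eq)
  have "abs_tensor p = abs_tensor (\<Sum>x\<in>keys p. single x (lookup p x))"
    by (simp flip: free_expand)
  then show ?thesis unfolding T sum single by blast
qed

instance tensor :: (fd_complex_algebra, fd_complex_algebra) fd_complex_algebra
proof
  obtain A :: "'a set" where A: "finite A" "\<And>x. \<exists>c. x = (\<Sum>a\<in>A. c a *\<^sub>C a)"
    using finite_spanning by metis
  obtain B :: "'b set" where B: "finite B" "\<And>x. \<exists>c. x = (\<Sum>b\<in>B. c b *\<^sub>C b)"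
    using finite_spanning by metis
  define C where "C = (\<lambda>(a, b). tens a b) ` (A \<times> B)"
  have sum_left: "tens (sum g I) y = (\<Sum>i\<in>I. tens (g i) y)"
    for g :: "'a \<Rightarrow> 'a" and I and y :: 'b
    by (rule additive.sum) (simp add: additive_def tens_add_left)
  have sum_right: "tens x (sum g I) = (\<Sum>i\<in>I. tens x (g i))"
    for g :: "'b \<Rightarrow> 'b" and I and x :: 'a
    by (rule additive.sum) (simp add: additive_def tens_add_right)
  have "tens x y \<in> cvs.span C" for x y
  proof -
    obtain c d where "x = (\<Sum>a\<in>A. c a *\<^sub>C a)" "y = (\<Sum>b\<in>B. d b *\<^sub>C b)"
      using A(2)[of x] B(2)[of y] by blast
    then have "tens x y = (\<Sum>a\<in>A. c a *\<^sub>C (\<Sum>b\<in>B. d b *\<^sub>C tens a b))"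
      by (simp only: sum_left)
        (simp add: sum_right tens_scaleC_left tens_scaleC_right cvs.scale_sum_right mult.commute)
    also have "\<dots> \<in> cvs.span C"
      by (intro cvs.span_sum cvs.span_scale cvs.span_base) (auto simp: C_def)
    finally show ?thesis .
  qed
  then have "T \<in> cvs.span C" for T
    using tensor_induct_expand[of T] by (auto intro: cvs.span_sum cvs.span_scale)
  moreover have "finite C" using A B by (simp add: C_def)
  ultimately show "\<exists>C::('a, 'b) tensor set. finite C \<and> (\<forall>x. \<exists>c. x = (\<Sum>b\<in>C. c b *\<^sub>C b))"
    by (intro exI[of _ C]) (auto simp: cvs.span_finite)
qed


section \<open>The characteristic polynomial\<close>

definition dual :: "('a::fd_complex_algebra \<Rightarrow> complex) set" where
  "dual = {F. Vector_Spaces.linear (*\<^sub>C) (*) F}"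

definition is_basis :: "'a::fd_complex_algebra list \<Rightarrow> bool" where
  "is_basis bs \<longleftrightarrow> distinct bs \<and> cvs.independent (set bs) \<and> cvs.span (set bs) = UNIV"

definition gram :: "'a::fd_complex_algebra list \<Rightarrow> ('a \<Rightarrow> complex) \<Rightarrow> complex mat" where
  "gram bs F = mat (length bs) (length bs) (\<lambda>(i, j). F (bs ! i * bs ! j))"

text \<open>Polynomials in \<open>\<lambda>\<close> and \<open>\<mu>\<close> are elements of
  \<^typ>\<open>complex poly poly\<close>: the outer variable is \<open>\<lambda>\<close>, the inner one \<open>\<mu>\<close>.\<close>

definition lam :: "complex poly poly" where "lam = [:0, 1:]"

definition mu :: "complex poly poly" where "mu = [:[:0, 1:]:]"

definition const :: "complex \<Rightarrow> complex poly poly" where "const c = [:[:c:]:]"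

definition chi_basis :: "'a::fd_complex_algebra list \<Rightarrow> ('a \<Rightarrow> complex) \<Rightarrow> complex poly poly" where
  "chi_basis bs F =
     (let A = map_mat const (gram bs F) in det (lam \<cdot>\<^sub>m A + mu \<cdot>\<^sub>m A\<^sup>T))"

text \<open>The characteristic polynomial is only defined up to a nonzero constant factor
  (lemma \<open>chi_basis_change\<close>); \<open>chi\<close> fixes it by choosing one basis. Being zero and
  divisibility do not depend on that choice.\<close>

definition chi :: "('a::fd_complex_algebra \<Rightarrow> complex) \<Rightarrow> complex poly poly" where
  "chi = chi_basis (SOME bs. is_basis bs)"

lemma ex_basis: "\<exists>bs::'a::fd_complex_algebra list. is_basis bs"
proof -
  obtain S :: "'a set" where S: "finite S" "\<And>x. \<exists>c. x = (\<Sum>a\<in>S. c a *\<^sub>C a)"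
    using finite_spanning by metis
  have UN: "cvs.span S = UNIV"
    using S by (auto simp: cvs.span_finite)
  obtain B where B: "B \<subseteq> S" "cvs.independent B" "S \<subseteq> cvs.span B"
    using cvs.maximal_independent_subset[of S] by metis
  have "cvs.span B = UNIV"
    using cvs.span_mono[OF B(3)] UN by (auto simp: cvs.span_span)
  moreover obtain bs where "set bs = B" "distinct bs"
    using finite_distinct_list finite_subset[OF B(1) S(1)] by metis
  ultimately show ?thesis
    using B by (auto simp: is_basis_def)
qed

lemma chi_basis_change:
  fixes bs cs :: "'a::fd_complex_algebra list"
  assumes bs: "is_basis bs" and cs: "is_basis cs" and F: "F \<in> dual"
  shows "\<exists>c. c \<noteq> 0 \<and> chi_basis bs F = const c * chi_basis cs F"
proof -
  interpret F: Vector_Spaces.linear "(*\<^sub>C)" "(*)" F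
    using F by (simp add: dual_def)
  have card: "length cs = length bs"
  proof -
    have "card (set bs) = card (set cs)"
      using bs cs unfolding is_basis_def
      by (metis cvs.dim_eq_card cvs.span_UNIV)
    then show ?thesis using bs cs by (simp add: is_basis_def distinct_card)
  qed
  define n where "n = length bs"
  define P where "P us vs = mat n n (\<lambda>(i, j). cvs.representation (set vs) (us ! i) (vs ! j))"
    for us vs :: "'a list"
  have expand: "us ! i = (\<Sum>j<n. P us vs $$ (i, j) *\<^sub>C vs ! j)"
    if "is_basis vs" "length vs = n" "i < n" for us vs i
  proof -
    have "us ! i = (\<Sum>b\<in>set vs. cvs.representation (set vs) (us ! i) b *\<^sub>C b)"
      using that by (subst cvs.sum_representation_eq) (auto simp: is_basis_def)
    also have "\<dots> = (\<Sum>j<n. cvs.representation (set vs) (us ! i) (vs ! j) *\<^sub>C vs ! j)"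
      using that by (intro sum.reindex_bij_betw[symmetric])
        (auto simp: is_basis_def bij_betw_nth lessThan_atLeast0)
    also have "\<dots> = (\<Sum>j<n. P us vs $$ (i, j) *\<^sub>C vs ! j)"
      using that by (simp add: P_def)
    finally show ?thesis .
  qed
  have [simp]: "P us vs \<in> carrier_mat n n" for us vs by (simp add: P_def)
  have "P bs cs * P cs bs = 1\<^sub>m n"
  proof (rule eq_matI)
    fix i j assume "i < dim_row (1\<^sub>m n :: complex mat)" "j < dim_col (1\<^sub>m n :: complex mat)"
    then have ij: "i < n" "j < n" by auto
    have "bs ! i = (\<Sum>k<n. P bs cs $$ (i, k) *\<^sub>C (\<Sum>l<n. P cs bs $$ (k, l) *\<^sub>C bs ! l))"
      using expand[of cs i bs] expand[of bs _ cs] bs cs card ij by (simp add: n_def)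
    also have "\<dots> = (\<Sum>l<n. \<Sum>k<n. P bs cs $$ (i, k) *\<^sub>C P cs bs $$ (k, l) *\<^sub>C bs ! l)"
      by (subst sum.swap) (simp add: cvs.scale_sum_right)
    also have "\<dots> = (\<Sum>l<n. (P bs cs * P cs bs) $$ (i, l) *\<^sub>C bs ! l)"
      using ij by (intro sum.cong refl)
        (simp add: P_def scalar_prod_def cvs.scale_sum_left lessThan_atLeast0)
    finally have "(\<Sum>l<n. ((P bs cs * P cs bs) $$ (i, l) - (if l = i then 1 else 0)) *\<^sub>C bs ! l) = 0"
      using ij by (simp add: cvs.scale_left_diff_distrib sum_subtractf if_distrib[of "\<lambda>c. c *\<^sub>C _"]
          cong: if_cong)
    moreover have "inj_on ((!) bs) {..<n}" "(!) bs ` {..<n} = set bs"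
      using bs bij_betw_nth[of bs "{..<n}" "set bs"] by (auto simp: is_basis_def n_def bij_betw_def)
    ultimately have "(\<Sum>b\<in>set bs. (let l = the_inv_into {..<n} ((!) bs) b in
        (P bs cs * P cs bs) $$ (i, l) - (if l = i then 1 else 0)) *\<^sub>C b) = 0"
      by (simp add: sum.reindex the_inv_into_f_f Let_def flip: \<open>(!) bs ` {..<n} = set bs\<close>)
    then have "(let l = the_inv_into {..<n} ((!) bs) (bs ! j) in
        (P bs cs * P cs bs) $$ (i, l) - (if l = i then 1 else 0)) = 0"
      using bs ij cvs.independentD[of "set bs" "set bs"]
      by (fastforce simp: is_basis_def n_def)
    then show "(P bs cs * P cs bs) $$ (i, j) = 1\<^sub>m n $$ (i, j)"
      using ij \<open>inj_on ((!) bs) {..<n}\<close> by (auto simp: the_inv_into_f_f)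
  qed (simp_all add: P_def)
  then have "det (P bs cs) * det (P cs bs) = 1"
    by (metis \<open>\<And>us vs. P us vs \<in> carrier_mat n n\<close> det_mult det_one)
  then have nz: "det (P bs cs) \<noteq> 0" by auto
  interpret const: comm_ring_hom const
    by unfold_locales (simp_all add: const_def one_pCons)
  define A where "A = map_mat const (gram cs F)"
  define Q where "Q = map_mat const (P bs cs)"
  have [simp]: "A \<in> carrier_mat n n" "Q \<in> carrier_mat n n"
    "gram cs F \<in> carrier_mat n n" "gram bs F \<in> carrier_mat n n"
    by (simp_all add: A_def Q_def P_def gram_def card n_def)
  have gram: "gram bs F = P bs cs * gram cs F * (P bs cs)\<^sup>T"
  proof (rule eq_matI)
    fix i j assume "i < dim_row (P bs cs * gram cs F * (P bs cs)\<^sup>T)"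
      "j < dim_col (P bs cs * gram cs F * (P bs cs)\<^sup>T)"
    then have ij: "i < n" "j < n" by (auto simp: P_def)
    have "gram bs F $$ (i, j) =
        F ((\<Sum>k<n. P bs cs $$ (i, k) *\<^sub>C cs ! k) * (\<Sum>l<n. P bs cs $$ (j, l) *\<^sub>C cs ! l))"
      using ij expand[of cs i bs] expand[of cs j bs] cs card by (simp add: gram_def n_def)
    also have "\<dots> = (\<Sum>k<n. \<Sum>l<n. P bs cs $$ (i, k) * P bs cs $$ (j, l) * F (cs ! k * cs ! l))"
      by (simp only: sum_product F.sum F.scale mult_scaleC_left mult_scaleC_right)
        (simp only: mult.assoc mult.left_commute)
    also have "\<dots> = (P bs cs * gram cs F * (P bs cs)\<^sup>T) $$ (i, j)"
    proof -
      have "(P bs cs * gram cs F * (P bs cs)\<^sup>T) $$ (i, j) =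
          (\<Sum>l<n. (\<Sum>k<n. P bs cs $$ (i, k) * F (cs ! k * cs ! l)) * P bs cs $$ (j, l))"
        using ij card by (simp add: P_def gram_def scalar_prod_def lessThan_atLeast0 n_def)
      also have "\<dots> = (\<Sum>l<n. \<Sum>k<n. P bs cs $$ (i, k) * P bs cs $$ (j, l) * F (cs ! k * cs ! l))"
        by (simp only: sum_distrib_right) (simp only: mult_ac)
      also have "\<dots> = (\<Sum>k<n. \<Sum>l<n. P bs cs $$ (i, k) * P bs cs $$ (j, l) * F (cs ! k * cs ! l))"
        by (rule sum.swap)
      finally show ?thesis ..
    qed
    finally show "gram bs F $$ (i, j) = (P bs cs * gram cs F * (P bs cs)\<^sup>T) $$ (i, j)" .
  qed (simp_all add: gram_def P_def n_def)
  have B: "map_mat const (gram bs F) = Q * A * Q\<^sup>T"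
    unfolding gram A_def Q_def
    by (simp add: const.mat_hom_mult[of _ n n _ n] mult_carrier_mat[of _ n n _ n] map_mat_transpose)
  have BT: "(Q * A * Q\<^sup>T)\<^sup>T = Q * A\<^sup>T * Q\<^sup>T"
    by (simp add: transpose_mult[of _ n n _ n] assoc_mult_mat[of _ n n _ n _ n]
        mult_carrier_mat[of _ n n _ n])
  have "lam \<cdot>\<^sub>m (Q * A * Q\<^sup>T) + mu \<cdot>\<^sub>m (Q * A\<^sup>T * Q\<^sup>T) =
        Q * (lam \<cdot>\<^sub>m A + mu \<cdot>\<^sub>m A\<^sup>T) * Q\<^sup>T"
    by (simp add: mult_add_distrib_mat[of _ n n _ n] add_mult_distrib_mat[of _ n n _ _ n]
        mult_smult_distrib[of _ n n _ n] mult_smult_assoc_mat[of _ n n _ n] mult_carrier_mat[of _ n n _ n])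
  then have "chi_basis bs F = det (Q * (lam \<cdot>\<^sub>m A + mu \<cdot>\<^sub>m A\<^sup>T) * Q\<^sup>T)"
    by (simp add: chi_basis_def B BT Let_def)
  also have "\<dots> = det Q * det Q * chi_basis cs F"
    by (simp add: det_mult[of _ n] mult_carrier_mat[of _ n n _ n] det_transpose[of _ n]
        chi_basis_def A_def[symmetric] mult_ac Let_def)
  also have "det Q * det Q = const (det (P bs cs) * det (P bs cs))"
    by (simp add: Q_def const.hom_det const.hom_mult)
  finally show ?thesis using nz by (metis mult_eq_0_iff)
qed

text \<open>Points of the projective line \<open>\<complex> \<union> {\<infinity>}\<close>.\<close>

datatype pline = Fin complex | Infty

text \<open>The zero polynomial has every point as a root.\<close>

fun is_root :: "pline \<Rightarrow> complex poly poly \<Rightarrow> bool" where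
  "is_root (Fin \<alpha>) p \<longleftrightarrow> (if \<alpha> = 0 then mu dvd p else lam + const (1 / \<alpha>) * mu dvd p)"
| "is_root Infty p \<longleftrightarrow> lam dvd p"


section \<open>Type 1, preciseness, index\<close>

text \<open>On \<^const>\<open>dual\<close> the topology of pointwise convergence, inherited from the product
  topology on \<^typ>\<open>'a \<Rightarrow> complex\<close>, is the Euclidean topology of a finite-dimensional space.\<close>

abbreviation open_in_dual :: "('a::fd_complex_algebra \<Rightarrow> complex) set \<Rightarrow> bool" where
  "open_in_dual U \<equiv> openin (top_of_set dual) U"

definition type1_alg :: "'a::fd_complex_algebra itself \<Rightarrow> bool" where
  "type1_alg _ \<longleftrightarrow>
     (\<exists>U::('a \<Rightarrow> complex) set. open_in_dual U \<and> U \<noteq> {} \<and> (\<forall>F\<in>U. chi F \<noteq> 0))"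

definition Stab :: "('a::fd_complex_algebra \<Rightarrow> complex) \<Rightarrow> complex \<Rightarrow> 'a set" where
  "Stab F \<alpha> = {a. \<forall>x. F (a * x) = \<alpha> * F (x * a)}"

text \<open>The zero polynomial has no highest power of \<open>\<lambda> + \<mu>\<close> dividing it, so
  \<^term>\<open>one_precise F\<close> entails \<^term>\<open>chi F \<noteq> 0\<close>.\<close>

definition one_precise :: "('a::fd_complex_algebra \<Rightarrow> complex) \<Rightarrow> bool" where
  "one_precise F \<longleftrightarrow>
     (let d = cvs.dim (Stab F 1) in (lam + mu) ^ d dvd chi F \<and> \<not> (lam + mu) ^ Suc d dvd chi F)"

definition one_precise_alg :: "'a::fd_complex_algebra itself \<Rightarrow> bool" where
  "one_precise_alg _ \<longleftrightarrow>
     (\<exists>U::('a \<Rightarrow> complex) set. open_in_dual U \<and> dual \<subseteq> closure U \<and> (\<forall>F\<in>U. one_precise F))"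

definition nontrivial_roots_vary :: "'a::fd_complex_algebra itself \<Rightarrow> bool" where
  "nontrivial_roots_vary _ \<longleftrightarrow>
     \<not> (\<exists>\<alpha>. \<alpha> \<noteq> Fin 1 \<and> (\<forall>F\<in>(dual :: ('a \<Rightarrow> complex) set). is_root \<alpha> (chi F)))"

definition one_regular :: "('a::fd_complex_algebra \<Rightarrow> complex) \<Rightarrow> bool" where
  "one_regular F \<longleftrightarrow>
     (\<exists>U. open_in_dual U \<and> F \<in> U \<and> (\<forall>G\<in>U. cvs.dim (Stab F 1) \<le> cvs.dim (Stab G 1)))"

text \<open>The value is the same at all 1-regular functionals, namely the minimum of
  \<^term>\<open>cvs.dim (Stab F 1)\<close> over the dual space.\<close>

definition ind :: "'a::fd_complex_algebra itself \<Rightarrow> nat" where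
  "ind _ = (THE d. \<exists>F::'a \<Rightarrow> complex. one_regular F \<and> d = cvs.dim (Stab F 1))"

end

theory Submission
  imports Defs "HOL-Library.Function_Algebras" "HOL-Computational_Algebra.Formal_Power_Series"
    "HOL-Computational_Algebra.Fundamental_Theorem_Algebra"
begin

text \<open>
  Write \<open>K\<^sub>F\<close> for \<^term>\<open>Stab F 1\<close>, the kernel of the skew form \<open>F(xy - yx)\<close>. The index is the
  least dimension of \<open>K\<^sub>F\<close> (\<open>ind_eq\<close>), so it suffices to find one functional on the tensor product
  whose stabiliser has the product dimension and is as small as possible. This functional is
  \<open>F \<otimes> G\<close> for suitably generic \<open>F\<close> and \<open>G\<close>.

  Generic \<open>F\<close> and \<open>G\<close> have two properties, collected in the locale \<open>split_functional\<close>. The algebra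
  \<open>K\<^sub>F\<close> is commutative, because \<open>K\<^sub>F\<close> has minimal dimension: a nonzero commutator of two of its
  elements would allow the rank of the skew form to grow in some direction
  (\<open>Stab_commutative_if_minimal\<close>). And the bilinear form \<open>F(ab)\<close> is nondegenerate on \<open>K\<^sub>F\<close>, because
  \<open>F\<close> is 1-precise: a degenerate direction is a Jordan block of size at least two at the root 1 and
  makes one more power of \<open>\<lambda> + \<mu>\<close> divide the characteristic polynomial
  (\<open>one_precise_Stab_nondegenerate\<close>).

  The stabiliser of \<open>F \<otimes> G\<close> is \<open>K\<^sub>F \<otimes> K\<^sub>G\<close>. If the form of \<open>F\<close> is nondegenerate, there is a linear map
  \<open>M\<close> with \<open>F(xa) = F(M(a)x)\<close>, and the stabiliser of \<open>F \<otimes> G\<close> is invariant under \<open>M \<otimes> 1\<close>. An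
  eigenvalue other than 1 of \<open>M \<otimes> 1\<close> on it would be a root of \<open>G\<close> whose inverse is a root of \<open>F\<close>.
  Once \<open>G\<close> is fixed these are finitely many values, and as no root other than 1 is constant on
  the dual of the first algebra, a generic \<open>F\<close> avoids all of them. Nondegeneracy on \<open>K\<^sub>F\<close> excludes
  Jordan blocks for the eigenvalue 1. Hence \<open>M \<otimes> 1\<close> is the identity on the stabiliser, which
  therefore lies in \<open>K\<^sub>F \<otimes> K\<^sub>G\<close> (\<open>Stab_functional_tensor_slices\<close>, \<open>split_functional_tensor\<close>).

  The functional \<open>F \<otimes> G\<close> inherits both properties, and they alone imply that no functional has a
  smaller stabiliser (\<open>dim_Stab_minimal\<close>). The reason is that the functionals \<open>y \<mapsto> F((1 + k)y)\<close> with
  \<open>k \<in> K\<^sub>F\<close> form a slice transversal to the coadjoint orbit of \<open>F\<close>, and each of them is stabilised by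
  the commutative algebra \<open>K\<^sub>F\<close>. Every deformation \<open>F + th\<close> is conjugate to a point of this slice by
  a formal power series \<open>1 + u(t)\<close>, so every element of \<open>K\<^sub>F\<close> extends to a formal power series
  stabilising \<open>F + th\<close>. The coefficients of these series span a space on which the ranks of the skew
  forms of \<open>F\<close> and of \<open>F + h\<close> can be compared, and the inequality holds at \<open>t = 1\<close>, not only for small \<open>t\<close>.
\<close>

section \<open>Rank and kernel of linear maps\<close>

text \<open>The codomain may have infinite dimension, so monotonicity of the dimension has to come from the
  finite basis of the image of the domain.\<close>

lemma (in finite_dimensional_vector_space_pair_1) dim_image_mono:
  assumes f: "Vector_Spaces.linear s1 s2 f" and S: "S \<subseteq> f ` W"
  shows "vs2.dim S \<le> vs2.dim (f ` W)"
proof -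
  obtain C where C: "C \<subseteq> f ` W" "vs2.independent C" "f ` W \<subseteq> vs2.span C" "card C = vs2.dim (f ` W)"
    using vs2.basis_exists by blast
  have "f ` W \<subseteq> vs2.span (f ` B1)"
    using linear_span_image[OF f, of B1] by (auto simp: vs1.span_Basis)
  then have "finite C"
    using C vs2.independent_span_bound[of "f ` B1" C] vs1.finite_Basis by blast
  then show ?thesis
    using vs2.dim_le_card[of S C] S C by fastforce
qed

lemma (in finite_dimensional_vector_space_pair_1) dim_kernel_image:
  assumes f: "Vector_Spaces.linear s1 s2 f" and W: "vs1.subspace W"
  shows "vs1.dim {x \<in> W. f x = 0} + vs2.dim (f ` W) = vs1.dim W"
proof -
  interpret f: Vector_Spaces.linear s1 s2 f by fact
  let ?K = "{x \<in> W. f x = 0}"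
  have K: "vs1.subspace ?K"
    using W by (auto simp: vs1.subspace_def f.add f.scale)
  obtain B where B: "B \<subseteq> ?K" "vs1.independent B" "vs1.span B = ?K" "card B = vs1.dim ?K"
    by (rule vs1.basis_subspace_exists[OF K])
  obtain D where D: "B \<subseteq> D" "D \<subseteq> W" "vs1.independent D" "W \<subseteq> vs1.span D"
    using vs1.maximal_independent_subset_extend[of B W] B by blast
  have fin: "finite D" "finite B"
    using D B vs1.finiteI_independent by blast+
  have spanD: "vs1.span D = W"
    by (rule vs1.span_subspace[OF D(2) D(4) W])
  have inj: "inj_on f (vs1.span (D - B))"
  proof (subst linear_inj_on_iff_eq_0[OF f vs1.subspace_span], intro ballI impI)
    fix x assume x: "x \<in> vs1.span (D - B)" "f x = 0"
    then have "x \<in> vs1.span B"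
      using vs1.span_mono[of "D - B" D] spanD B by auto
    then have r: "vs1.representation D x = vs1.representation B x"
      using vs1.representation_extend[OF D(3) _ D(1)] by blast
    have r': "vs1.representation D x = vs1.representation (D - B) x"
      using vs1.representation_extend[OF D(3) x(1)] by blast
    have "vs1.representation D x b = 0" for b
      using vs1.representation_ne_zero[of B x b] vs1.representation_ne_zero[of "D - B" x b] r r'
      by auto
    then have "(\<Sum>b\<in>D. s1 (vs1.representation D x b) b) = 0"
      by simp
    moreover have "x \<in> vs1.span D"
      using x(1) vs1.span_mono[of "D - B" D] by auto
    ultimately show "x = 0"
      using vs1.sum_representation_eq[OF D(3) _ fin(1) order_refl] by simp
  qed
  have "f ` W = vs2.span (f ` D)"
    using linear_span_image[OF f, of D] spanD by simp
  also have "\<dots> = vs2.span (f ` (D - B))"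
  proof -
    have "f ` D \<subseteq> insert 0 (f ` (D - B))"
      using B(1) by auto
    from vs2.span_mono[OF this] have "vs2.span (f ` D) \<subseteq> vs2.span (f ` (D - B))"
      by simp
    moreover have "vs2.span (f ` (D - B)) \<subseteq> vs2.span (f ` D)"
      by (intro vs2.span_mono) auto
    ultimately show ?thesis by blast
  qed
  finally have im: "f ` W = vs2.span (f ` (D - B))" .
  have "vs1.independent (D - B)"
    using D(3) vs1.independent_mono by blast
  then have "vs2.independent (f ` (D - B))"
    using linear_independent_injective_image[OF f] inj by blast
  from vs2.dim_span_eq_card_independent[OF this] have "vs2.dim (f ` W) = card (f ` (D - B))"
    by (simp only: im)
  also have "\<dots> = card (D - B)"
    by (intro card_image inj_on_subset[OF inj] vs1.span_superset)
  also have "\<dots> = card D - card B"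
    by (rule card_Diff_subset[OF fin(2) D(1)])
  moreover have "card D = vs1.dim W"
    using vs1.dim_span_eq_card_independent[OF D(3)] spanD by simp
  ultimately show ?thesis
    using B(4) card_mono[OF fin(1) D(1)] by simp
qed

global_interpretation fdv: finite_dimensional_vector_space
  "scaleC :: complex \<Rightarrow> 'a \<Rightarrow> 'a::fd_complex_algebra" "set (SOME bs. is_basis bs)"
proof -
  have "is_basis (SOME bs::'a list. is_basis bs)"
    using ex_basis by (rule someI_ex)
  then show "finite_dimensional_vector_space (scaleC :: complex \<Rightarrow> 'a \<Rightarrow> 'a) (set (SOME bs. is_basis bs))"
    by unfold_locales (auto simp: is_basis_def)
qed

text \<open>The skew form of a functional is regarded as a linear map from the algebra into the vector space of
  all functions on it; the interpretation \<open>form_pair\<close> makes rank and nullity of such maps available.\<close>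

global_interpretation fun_vs: vector_space "\<lambda>(c::complex) (f::'a \<Rightarrow> complex) x. c * f x"
  by unfold_locales (auto simp: fun_eq_iff algebra_simps)

global_interpretation form_pair: finite_dimensional_vector_space_pair_1
  "scaleC :: complex \<Rightarrow> 'a \<Rightarrow> 'a::fd_complex_algebra" "set (SOME bs. is_basis bs)"
  "\<lambda>(c::complex) (f::'a \<Rightarrow> complex) x. c * f x"
  by unfold_locales

(* It would express the dimension of the algebra through an arbitrarily chosen basis. *)
declare fdv.dim_UNIV [simp del]

section \<open>Functionals and linear pencils\<close>

lemma dual_add: "F \<in> dual \<Longrightarrow> F (x + y) = F x + F y"
  and dual_scale: "F \<in> dual \<Longrightarrow> F (c *\<^sub>C x) = c * F x"
  using Vector_Spaces.linear.axioms(3) module_hom.add module_hom.scale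
  unfolding dual_def Vector_Spaces.linear_def by blast+

lemma dual_zero: "F \<in> dual \<Longrightarrow> F 0 = 0"
  using dual_add[of F 0 0] by simp

lemma dual_diff: "F \<in> dual \<Longrightarrow> F (x - y) = F x - F y"
  using dual_add[of F "x - y" y] by simp

lemma dual_sum: "F \<in> dual \<Longrightarrow> F (sum g I) = (\<Sum>i\<in>I. F (g i))"
  by (induction I rule: infinite_finite_induct) (simp_all add: dual_zero dual_add)

lemma dualI:
  assumes "\<And>x y. F (x + y) = F x + F y" "\<And>c x. F (c *\<^sub>C x) = c * F x"
  shows "F \<in> dual"
  unfolding dual_def using assms
  by (auto intro!: Vector_Spaces.linear.intro module_hom.intro module_hom_axioms.intro
      cvs.vector_space_axioms cvs.module_axioms simp: module_iff_vector_space[symmetric])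
    (unfold_locales, auto simp: algebra_simps)

lemmas dual_simps = dual_add dual_scale dual_zero dual_diff dual_sum

text \<open>The bilinear form with matrix \<open>p A\<^sub>F + q A\<^sub>F\<^sup>T\<close>, curried. The case \<open>p = 1, q = -1\<close> is the skew
  form, whose kernel is \<^term>\<open>Stab F 1\<close>.\<close>

definition pencil :: "('a::fd_complex_algebra \<Rightarrow> complex) \<Rightarrow> complex \<Rightarrow> complex \<Rightarrow> 'a \<Rightarrow> 'a \<Rightarrow> complex" where
  "pencil F p q a x = p * F (a * x) + q * F (x * a)"

definition nondegenerate :: "complex \<Rightarrow> complex \<Rightarrow> ('a::fd_complex_algebra \<Rightarrow> complex) \<Rightarrow> bool" where
  "nondegenerate p q F \<longleftrightarrow> (\<forall>a. (\<forall>x. pencil F p q a x = 0) \<longrightarrow> a = 0)"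

abbreviation linear_form :: "('a::fd_complex_algebra \<Rightarrow> 'b \<Rightarrow> complex) \<Rightarrow> bool" where
  "linear_form \<equiv> Vector_Spaces.linear (*\<^sub>C) (\<lambda>c f x. c * f x)"

lemma linear_formI:
  assumes "\<And>a b x. X (a + b) x = X a x + X b x" "\<And>c a x. X (c *\<^sub>C a) x = c * X a x"
  shows "linear_form X"
  by unfold_locales (auto simp: fun_eq_iff assms)

lemma linear_form_add: "linear_form X \<Longrightarrow> X (a + b) x = X a x + X b x"
  and linear_form_scale: "linear_form X \<Longrightarrow> X (c *\<^sub>C a) x = c * X a x"
  by (simp_all add: Vector_Spaces.linear_iff)

lemma linear_form_sum:
  assumes "linear_form X" shows "X (sum g I) x = (\<Sum>i\<in>I. X (g i) x)"
proof -
  have "X 0 x = 0" using linear_form_add[OF assms, of 0 0 x] by simp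
  then show ?thesis
    by (induction I rule: infinite_finite_induct) (simp_all add: linear_form_add[OF assms])
qed

lemma linear_form_pencil: "F \<in> dual \<Longrightarrow> linear_form (pencil F p q)"
  by (rule linear_formI)
    (simp_all add: pencil_def distrib_left distrib_right dual_simps mult_scaleC_left
      mult_scaleC_right algebra_simps)

lemma Stab_pencil: "Stab F 1 = {a \<in> UNIV. pencil F 1 (-1) a = 0}"
  by (auto simp: Stab_def pencil_def fun_eq_iff)

lemma dim_Stab:
  fixes F :: "'a::fd_complex_algebra \<Rightarrow> complex"
  assumes "F \<in> dual"
  shows "cvs.dim (Stab F 1) + fun_vs.dim (range (pencil F 1 (-1))) = cvs.dim (UNIV :: 'a set)"
  unfolding Stab_pencil
  using assms by (intro form_pair.dim_kernel_image) (simp_all add: linear_form_pencil)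

lemma subspace_Stab: "F \<in> dual \<Longrightarrow> cvs.subspace (Stab F 1)"
  by (auto simp: Stab_def cvs.subspace_def distrib_left distrib_right dual_simps
      mult_scaleC_left mult_scaleC_right)

lemma independent_family:
  fixes v :: "'i \<Rightarrow> 'a::complex_algebra"
  assumes fin: "finite I" and ind: "\<And>c. (\<Sum>i\<in>I. c i *\<^sub>C v i) = 0 \<Longrightarrow> \<forall>i\<in>I. c i = 0"
  shows "inj_on v I" "cvs.independent (v ` I)"
proof -
  show inj: "inj_on v I"
  proof (rule inj_onI, rule ccontr)
    fix s t assume st: "s \<in> I" "t \<in> I" "v s = v t" "s \<noteq> t"
    have "(\<Sum>r\<in>I. (if r = s then 1 else if r = t then -1 else 0) *\<^sub>C v r)
        = (\<Sum>r\<in>{s,t}. (if r = s then 1 else if r = t then -1 else 0) *\<^sub>C v r)"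
      using st fin by (intro sum.mono_neutral_right) auto
    also have "\<dots> = 0" using st by simp
    finally show False using ind st by force
  qed
  show "cvs.independent (v ` I)"
  proof (subst cvs.independent_explicit_finite_subsets, intro allI impI ballI)
    fix B u b assume B: "B \<subseteq> v ` I" "finite B" "(\<Sum>b\<in>B. u b *\<^sub>C b) = 0" "b \<in> B"
    have "(\<Sum>t\<in>I. (if v t \<in> B then u (v t) else 0) *\<^sub>C v t) = (\<Sum>b\<in>v ` I. (if b \<in> B then u b else 0) *\<^sub>C b)"
      by (simp add: sum.reindex[OF inj])
    also have "\<dots> = (\<Sum>b\<in>B. u b *\<^sub>C b)"
      using B fin by (intro sum.mono_neutral_cong_right) auto
    finally have "(\<Sum>t\<in>I. (if v t \<in> B then u (v t) else 0) *\<^sub>C v t) = 0"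
      using B(3) by simp
    from ind[OF this] show "u b = 0" using B(1,4) by force
  qed
qed

text \<open>The quotient \<open>(X + rY)\<^sup>-\<^sup>1 Y\<close> makes sense on the vectors in question, and \<open>v t\<close> is an eigenvector of it
  for the eigenvalue \<open>1/(r - t)\<close>; so this is the independence of eigenvectors for distinct
  eigenvalues.\<close>

lemma pencil_kernel_vectors_independent:
  fixes X Y :: "'a::fd_complex_algebra \<Rightarrow> 'b \<Rightarrow> complex"
  assumes X: "linear_form X" and Y: "linear_form Y" and L: "cvs.subspace L"
    and inj: "\<And>x. x \<in> L \<Longrightarrow> (\<And>y. X x y + r * Y x y = 0) \<Longrightarrow> x = 0"
    and "finite S" and "r \<notin> S"
    and "\<And>t. t \<in> S \<Longrightarrow> v t \<in> L \<and> v t \<noteq> 0 \<and> (\<forall>y. X (v t) y + t * Y (v t) y = 0)"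
    and "(\<Sum>t\<in>S. d t *\<^sub>C v t) = 0"
  shows "\<forall>t\<in>S. d t = 0"
  using assms(5-8)
proof (induction S arbitrary: d rule: finite_induct)
  case (insert s S)
  \<comment> \<open>A relation with coefficients \<open>d\<close> yields one with coefficients \<open>d t / (r - t)\<close>, since \<open>X + rY\<close> maps
    the latter combination to \<open>Y\<close> applied to the former.\<close>
  let ?e = "\<lambda>t. inverse (r - t)"
  let ?z = "\<Sum>t\<in>insert s S. (d t * ?e t) *\<^sub>C v t"
  have "X ?z y + r * Y ?z y = 0" for y
  proof -
    have "X ?z y + r * Y ?z y
        = (\<Sum>t\<in>insert s S. d t * ?e t * (X (v t) y + r * Y (v t) y))"
      by (simp only: linear_form_sum[OF X] linear_form_sum[OF Y] linear_form_scale[OF X]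
          linear_form_scale[OF Y] sum_distrib_left sum.distrib[symmetric])
        (simp add: algebra_simps)
    also have "\<dots> = (\<Sum>t\<in>insert s S. d t * Y (v t) y)"
    proof (rule sum.cong[OF refl])
      fix t assume t: "t \<in> insert s S"
      then have "X (v t) y = - t * Y (v t) y"
        using insert.prems(2)[OF t] by (simp add: eq_neg_iff_add_eq_0)
      moreover have "r - t \<noteq> 0" using t insert.prems(1) by auto
      ultimately show "d t * ?e t * (X (v t) y + r * Y (v t) y) = d t * Y (v t) y"
        by (simp add: field_simps)
    qed
    also have "\<dots> = Y (\<Sum>t\<in>insert s S. d t *\<^sub>C v t) y"
      by (simp only: linear_form_sum[OF Y] linear_form_scale[OF Y])
    also have "\<dots> = 0"
      unfolding insert.prems(3) using linear_form_scale[OF Y, of 0 0 y] by simp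
    finally show ?thesis .
  qed
  moreover have "?z \<in> L"
    using L insert.prems(2) by (intro cvs.subspace_sum cvs.subspace_scale) auto
  ultimately have z: "?z = 0" using inj by blast
  have "(\<Sum>t\<in>S. (d t * (?e t - ?e s)) *\<^sub>C v t) = (\<Sum>t\<in>insert s S. (d t * (?e t - ?e s)) *\<^sub>C v t)"
    using insert.hyps by simp
  also have "\<dots> = ?z - ?e s *\<^sub>C (\<Sum>t\<in>insert s S. d t *\<^sub>C v t)"
    by (simp only: cvs.scale_sum_right sum_subtractf[symmetric])
      (simp add: cvs.scale_left_diff_distrib right_diff_distrib mult.commute)
  also have "\<dots> = 0" using z insert.prems(3) by simp
  finally have S: "\<forall>t\<in>S. d t * (?e t - ?e s) = 0"
    using insert.IH[of "\<lambda>t. d t * (?e t - ?e s)"] insert.prems by auto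
  have "d t = 0" if "t \<in> S" for t
  proof -
    have "?e t \<noteq> ?e s"
      using that insert.hyps by auto
    then show ?thesis using S that by auto
  qed
  moreover from this have "d s = 0"
    using insert.prems insert.hyps by simp
  ultimately show ?case by blast
qed simp

text \<open>Injectivity on \<open>L\<close> is a Zariski open condition on the parameter of the pencil: more than
  \<open>dim L\<close> exceptional parameters would give too many independent vectors.\<close>

lemma pencil_injective_cofinite:
  fixes X Y :: "'a::fd_complex_algebra \<Rightarrow> 'b \<Rightarrow> complex"
  assumes X: "linear_form X" and Y: "linear_form Y" and L: "cvs.subspace L"
    and inj: "\<And>x. x \<in> L \<Longrightarrow> (\<And>y. X x y + r * Y x y = 0) \<Longrightarrow> x = 0"
  shows "finite {t. \<exists>x\<in>L. x \<noteq> 0 \<and> (\<forall>y. X x y + t * Y x y = 0)}" (is "finite ?T")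
proof (rule ccontr)
  assume "infinite ?T"
  then obtain S where S: "S \<subseteq> ?T" "finite S" "card S = Suc (cvs.dim (UNIV :: 'a set))"
    using infinite_arbitrarily_large by blast
  define v where "v t = (SOME x. x \<in> L \<and> x \<noteq> 0 \<and> (\<forall>y. X x y + t * Y x y = 0))" for t
  have v: "v t \<in> L \<and> v t \<noteq> 0 \<and> (\<forall>y. X (v t) y + t * Y (v t) y = 0)" if "t \<in> S" for t
  proof -
    have "\<exists>x. x \<in> L \<and> x \<noteq> 0 \<and> (\<forall>y. X x y + t * Y x y = 0)"
      using S(1) that by auto
    from someI_ex[OF this] show ?thesis unfolding v_def .
  qed
  have "r \<notin> S"
  proof
    assume "r \<in> S"
    from v[OF this] have "v r = 0" by (intro inj) auto
    with v[OF \<open>r \<in> S\<close>] show False by simp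
  qed
  then have ind: "\<forall>t\<in>S. d t = 0" if "(\<Sum>t\<in>S. d t *\<^sub>C v t) = 0" for d
    using that inj v S(2) by (intro pencil_kernel_vectors_independent[OF X Y L, of r S v d]) auto
  note family = independent_family[where v = v, OF S(2) ind]
  have "cvs.independent (v ` S)"
    by (rule family(2))
  then have "card (v ` S) \<le> cvs.dim (UNIV :: 'a set)"
    using fdv.independent_card_le_dim by blast
  then show False using S(3) by (simp add: card_image[OF family(1)])
qed

section \<open>Generic functionals\<close>

definition line :: "('a \<Rightarrow> complex) \<Rightarrow> ('a \<Rightarrow> complex) \<Rightarrow> complex \<Rightarrow> 'a \<Rightarrow> complex" where
  "line F G t x = F x + t * (G x - F x)"

lemma line_in_dual: "F \<in> dual \<Longrightarrow> G \<in> dual \<Longrightarrow> line F G t \<in> dual"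
  by (rule dualI) (simp_all add: line_def dual_simps algebra_simps)

lemma line_0 [simp]: "line F G 0 = F"
  by (simp add: line_def fun_eq_iff)

lemma line_swap: "line F G (1 - t) = line G F t"
  by (simp add: line_def fun_eq_iff algebra_simps)

lemma pencil_line: "pencil (line F G t) p q a x
    = pencil F p q a x + t * (pencil G p q a x - pencil F p q a x)"
  by (simp add: pencil_def line_def algebra_simps)

text \<open>A substitute for non-empty Zariski open sets of functionals: on each line through a functional with
  the property, the property fails at finitely many points only. This is stable under finite
  conjunctions and enough to meet every non-empty Euclidean open set, and it needs no polynomials
  in several variables.\<close>

definition generic :: "(('a::fd_complex_algebra \<Rightarrow> complex) \<Rightarrow> bool) \<Rightarrow> bool" where
  "generic C \<longleftrightarrow> (\<exists>F\<in>dual. C F) \<and>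
     (\<forall>F\<in>dual. \<forall>G\<in>dual. C G \<longrightarrow> finite {t. \<not> C (line F G t)})"

text \<open>On the line that joins a witness for \<open>C\<close> to a witness for \<open>D\<close>, both conditions fail only finitely
  often.\<close>

lemma generic_conj:
  assumes C: "generic C" and D: "generic D"
  shows "generic (\<lambda>F. C F \<and> D F)"
proof -
  obtain F G where FG: "F \<in> dual" "G \<in> dual" "C F" "D G"
    using C D unfolding generic_def by blast
  have fD: "finite {t. \<not> D (line F G t)}" and fC: "finite {t. \<not> C (line G F t)}"
    using C D FG unfolding generic_def by blast+
  have "finite ((\<lambda>t. 1 - t) ` {t. \<not> C (line G F t)})"
    using fC by simp
  moreover have "{t. \<not> C (line F G t)} \<subseteq> (\<lambda>t. 1 - t) ` {t. \<not> C (line G F t)}"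
  proof
    fix t assume "t \<in> {t. \<not> C (line F G t)}"
    then have "\<not> C (line G F (1 - t))" by (simp add: line_swap)
    then show "t \<in> (\<lambda>t. 1 - t) ` {t. \<not> C (line G F t)}"
      by (intro image_eqI[of _ _ "1 - t"]) auto
  qed
  ultimately have "finite {t. \<not> C (line F G t)}"
    using finite_subset by blast
  then have "finite ({t. \<not> C (line F G t)} \<union> {t. \<not> D (line F G t)})"
    using fD by simp
  then obtain t where "t \<notin> {t. \<not> C (line F G t)} \<union> {t. \<not> D (line F G t)}"
    using ex_new_if_finite[OF infinite_UNIV_char_0] by blast
  then have "\<exists>H\<in>dual. C H \<and> D H"
    using line_in_dual[OF FG(1,2)] by blast
  moreover have "finite {t. \<not> (C (line F G t) \<and> D (line F G t))}"
    if "F \<in> dual" "G \<in> dual" "C G \<and> D G" for F G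
  proof -
    have "finite ({t. \<not> C (line F G t)} \<union> {t. \<not> D (line F G t)})"
      using C D that unfolding generic_def by simp
    then show ?thesis by (rule finite_subset[rotated]) auto
  qed
  ultimately show ?thesis unfolding generic_def by blast
qed

lemma dual_zero_fun: "(\<lambda>_. 0) \<in> dual"
  by (rule dualI) simp_all

lemma generic_Ball:
  assumes "finite I" "\<And>i. i \<in> I \<Longrightarrow> generic (C i)"
  shows "generic (\<lambda>F. \<forall>i\<in>I. C i F)"
  using assms
proof (induction I rule: finite_induct)
  case empty
  show ?case using dual_zero_fun by (auto simp: generic_def)
next
  case (insert i I)
  then show ?case using generic_conj[of "C i" "\<lambda>F. \<forall>i\<in>I. C i F"] by simp
qed

text \<open>A line through a point of \<open>U\<close> stays in \<open>U\<close> for infinitely many parameters.\<close>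

lemma generic_meets_open:
  fixes U :: "('a::fd_complex_algebra \<Rightarrow> complex) set"
  assumes C: "generic C" and U: "open_in_dual U" "F \<in> U"
  shows "\<exists>G\<in>U. C G"
proof -
  obtain V where V: "open V" "U = dual \<inter> V"
    using U(1) by (metis openin_open)
  have F: "F \<in> dual" using U(2) V(2) by blast
  obtain G where G: "G \<in> dual" "C G" using C unfolding generic_def by blast
  have "continuous_on UNIV (\<lambda>t. line F G t)"
    by (intro continuous_on_coordinatewise_then_product) (auto simp: line_def intro!: continuous_intros)
  then have "open ((\<lambda>t. line F G t) -` V)"
    using V(1) by (simp add: continuous_on_open_vimage)
  moreover have "0 \<in> (\<lambda>t. line F G t) -` V"
    using U(2) V(2) by simp
  ultimately have "\<not> finite ((\<lambda>t. line F G t) -` V)"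
    using islimpt_UNIV[of "0::complex"] islimpt_eq_acc_point[of "0::complex" UNIV] by force
  moreover have "finite {t. \<not> C (line F G t)}"
    using C F G unfolding generic_def by blast
  ultimately have "\<exists>t. t \<in> (\<lambda>t. line F G t) -` V \<and> C (line F G t)"
    by (metis (mono_tags, lifting) finite_subset mem_Collect_eq subsetI)
  then show ?thesis
    using V(2) line_in_dual[OF F G(1)] by blast
qed

lemma generic_nondegenerate:
  fixes F :: "'a::fd_complex_algebra \<Rightarrow> complex"
  assumes "F \<in> dual" "nondegenerate p q F"
  shows "generic (nondegenerate p q :: ('a \<Rightarrow> complex) \<Rightarrow> bool)"
proof -
  have "finite {t. \<not> nondegenerate p q (line F G t)}"
    if FG: "F \<in> dual" "G \<in> dual" and G: "nondegenerate p q G" for F G :: "'a \<Rightarrow> complex"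
  proof -
    have Y: "linear_form (\<lambda>a x. pencil G p q a x - pencil F p q a x)"
      using linear_form_pencil[OF FG(1)] linear_form_pencil[OF FG(2)]
      by (intro linear_formI) (simp_all add: linear_form_add linear_form_scale algebra_simps)
    have "finite {t. \<exists>x\<in>UNIV. x \<noteq> 0 \<and> (\<forall>y. pencil F p q x y + t * (pencil G p q x y - pencil F p q x y) = 0)}"
      by (rule pencil_injective_cofinite[OF linear_form_pencil[OF FG(1)] Y cvs.subspace_UNIV, where r = 1])
        (use G in \<open>simp add: nondegenerate_def\<close>)
    then show ?thesis
      by (rule finite_subset[rotated]) (auto simp: nondegenerate_def pencil_line)
  qed
  then show ?thesis using assms unfolding generic_def by fast
qed

section \<open>Minimal stabilisers and the index\<close>

lemma dim_Stab_le_if_injective: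
  fixes F :: "'a::fd_complex_algebra \<Rightarrow> complex"
  assumes F: "F \<in> dual" and L: "cvs.subspace L"
    and inj: "\<And>x. x \<in> L \<Longrightarrow> (\<And>y. pencil F 1 (-1) x y = 0) \<Longrightarrow> x = 0"
  shows "cvs.dim (Stab F 1) + cvs.dim L \<le> cvs.dim (UNIV :: 'a set)"
proof -
  have "fun_vs.dim (pencil F 1 (-1) ` L) = cvs.dim L"
  proof (rule form_pair.dim_image_eq[OF linear_form_pencil[OF F]])
    have "cvs.span L = L" using L by (simp add: cvs.span_eq_iff)
    moreover have "x = 0" if "x \<in> L" "pencil F 1 (-1) x = 0" for x
      using inj[OF that(1)] that(2) by (simp add: fun_eq_iff)
    ultimately show "inj_on (pencil F 1 (-1)) (cvs.span L)"
      using form_pair.linear_inj_on_iff_eq_0[OF linear_form_pencil[OF F] L] by metis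
  qed
  moreover have "fun_vs.dim (pencil F 1 (-1) ` L) \<le> fun_vs.dim (range (pencil F 1 (-1)))"
    by (rule form_pair.dim_image_mono[OF linear_form_pencil[OF F]]) auto
  ultimately show ?thesis using dim_Stab[OF F] by linarith
qed

text \<open>The skew form is injective on the complement of \<^term>\<open>Stab F 1\<close> spanned by the remaining basis
  vectors; \<open>ex_Stab_basis\<close> supplies such adapted bases.\<close>

lemma Stab_complement:
  fixes F :: "'a::fd_complex_algebra \<Rightarrow> complex"
  assumes F: "F \<in> dual" and B: "B \<subseteq> Stab F 1" "cvs.independent B" "cvs.span B = Stab F 1"
    and D: "B \<subseteq> D" "cvs.independent D" "cvs.span D = UNIV"
    and x: "x \<in> cvs.span (D - B)" "\<And>y. pencil F 1 (-1) x y = 0"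
  shows "x = 0"
proof -
  have "x \<in> cvs.span B" using x(2) B(3) by (auto simp: Stab_pencil fun_eq_iff)
  then have r: "cvs.representation D x = cvs.representation B x"
    using cvs.representation_extend[OF D(2) _ D(1)] by blast
  have r': "cvs.representation D x = cvs.representation (D - B) x"
    using cvs.representation_extend[OF D(2) x(1)] by blast
  have "cvs.representation D x b = 0" for b
    using cvs.representation_ne_zero[of B x b] cvs.representation_ne_zero[of "D - B" x b] r r'
    by auto
  then have "(\<Sum>b\<in>D. cvs.representation D x b *\<^sub>C b) = 0"
    by simp
  then show "x = 0"
    using cvs.sum_representation_eq[OF D(2) _ fdv.finiteI_independent[OF D(2)] order_refl, of x] D(3) by simp
qed

lemma ex_Stab_basis:
  fixes F :: "'a::fd_complex_algebra \<Rightarrow> complex"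
  assumes F: "F \<in> dual" and A: "A \<subseteq> Stab F 1" "cvs.independent A"
  obtains B D where "A \<subseteq> B" "B \<subseteq> Stab F 1" "cvs.independent B" "cvs.span B = Stab F 1"
    "B \<subseteq> D" "cvs.independent D" "cvs.span D = UNIV" "finite D"
    "card B = cvs.dim (Stab F 1)" "card D = cvs.dim (UNIV :: 'a set)"
proof -
  obtain B where B: "A \<subseteq> B" "B \<subseteq> Stab F 1" "cvs.independent B" "Stab F 1 \<subseteq> cvs.span B"
    using cvs.maximal_independent_subset_extend[OF A] by blast
  obtain D where D: "B \<subseteq> D" "D \<subseteq> UNIV" "cvs.independent D" "UNIV \<subseteq> cvs.span D"
    using cvs.maximal_independent_subset_extend[OF _ B(3), of UNIV] by blast
  have sB: "cvs.span B = Stab F 1"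
    using B subspace_Stab[OF F] by (metis cvs.span_subspace)
  show thesis
  proof (rule that[OF B(1-3) sB D(1) D(3)])
    show "cvs.span D = UNIV" using D by auto
    show "finite D" using D fdv.finiteI_independent by blast
    show "card B = cvs.dim (Stab F 1)" by (metis B(3) sB cvs.dim_span_eq_card_independent)
    show "card D = cvs.dim (UNIV :: 'a set)" using D by (metis cvs.dim_span_eq_card_independent top.extremum_unique)
  qed
qed

text \<open>Lower semicontinuity of the rank: the skew form of \<open>G\<close> is injective on a complement of its kernel,
  and injectivity there persists at all but finitely many points of a line.\<close>

lemma generic_dim_Stab:
  fixes F0 :: "'a::fd_complex_algebra \<Rightarrow> complex"
  assumes "F0 \<in> dual" "cvs.dim (Stab F0 1) \<le> d"
  shows "generic (\<lambda>F::'a \<Rightarrow> complex. cvs.dim (Stab F 1) \<le> d)"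
proof -
  have "finite {t. \<not> cvs.dim (Stab (line F G t) 1) \<le> d}"
    if FG: "F \<in> dual" "G \<in> dual" and G: "cvs.dim (Stab G 1) \<le> d" for F G :: "'a \<Rightarrow> complex"
  proof -
    obtain B D where BD: "{} \<subseteq> B" "B \<subseteq> Stab G 1" "cvs.independent B" "cvs.span B = Stab G 1"
      "B \<subseteq> D" "cvs.independent D" "cvs.span D = UNIV" "finite D"
      "card B = cvs.dim (Stab G 1)" "card D = cvs.dim (UNIV :: 'a set)"
      by (rule ex_Stab_basis[OF FG(2), of "{}"]) (auto simp: cvs.independent_empty)
    let ?L = "cvs.span (D - B)"
    have dimL: "cvs.dim ?L = card D - card B"
      using BD by (metis card_Diff_subset cvs.dim_span_eq_card_independent cvs.independent_mono
          Diff_subset finite_subset)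
    have le: "card B \<le> card D" by (rule card_mono[OF BD(8,5)])
    let ?S = "\<lambda>F. pencil F 1 (-1)"
    have Y: "linear_form (\<lambda>a x. ?S G a x - ?S F a x)"
      using linear_form_pencil[OF FG(1)] linear_form_pencil[OF FG(2)]
      by (intro linear_formI) (simp_all add: linear_form_add linear_form_scale algebra_simps)
    have "finite {t. \<exists>x\<in>?L. x \<noteq> 0 \<and> (\<forall>y. ?S F x y + t * (?S G x y - ?S F x y) = 0)}"
      by (rule pencil_injective_cofinite[OF linear_form_pencil[OF FG(1)] Y cvs.subspace_span, where r = 1])
        (use Stab_complement[OF FG(2) BD(2-7)] in simp)
    moreover have "{t. \<not> cvs.dim (Stab (line F G t) 1) \<le> d} \<subseteq>
        {t. \<exists>x\<in>?L. x \<noteq> 0 \<and> (\<forall>y. ?S F x y + t * (?S G x y - ?S F x y) = 0)}"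
    proof (rule subsetI, rule ccontr)
      fix t assume t: "t \<in> {t. \<not> cvs.dim (Stab (line F G t) 1) \<le> d}"
        "t \<notin> {t. \<exists>x\<in>?L. x \<noteq> 0 \<and> (\<forall>y. ?S F x y + t * (?S G x y - ?S F x y) = 0)}"
      have "cvs.dim (Stab (line F G t) 1) + cvs.dim ?L \<le> cvs.dim (UNIV :: 'a set)"
        by (rule dim_Stab_le_if_injective[OF line_in_dual[OF FG] cvs.subspace_span])
          (use t(2) in \<open>auto simp: pencil_line\<close>)
      then show False using t(1) G dimL BD(9,10) le by simp
    qed
    ultimately show ?thesis by (rule finite_subset[rotated])
  qed
  then show ?thesis using assms unfolding generic_def by blast
qed

text \<open>The index is defined through local minima. Near any functional there are functionals whose stabiliser
  is as small as the globally minimal one, so a local minimum is a global one.\<close>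

lemma ind_eq:
  fixes F0 :: "'a::fd_complex_algebra \<Rightarrow> complex"
  assumes F0: "F0 \<in> dual" and min: "\<And>F::'a \<Rightarrow> complex. F \<in> dual \<Longrightarrow> cvs.dim (Stab F0 1) \<le> cvs.dim (Stab F 1)"
  shows "ind TYPE('a) = cvs.dim (Stab F0 1)"
  unfolding ind_def
proof (rule the_equality)
  have "one_regular F0"
    unfolding one_regular_def using F0 min by (intro exI[of _ dual]) auto
  then show "\<exists>F::'a \<Rightarrow> complex. one_regular F \<and> cvs.dim (Stab F0 1) = cvs.dim (Stab F 1)" by blast
next
  fix d assume "\<exists>F::'a \<Rightarrow> complex. one_regular F \<and> d = cvs.dim (Stab F 1)"
  then obtain F :: "'a \<Rightarrow> complex" and U where F: "d = cvs.dim (Stab F 1)" "open_in_dual U" "F \<in> U"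
    "\<forall>G\<in>U. cvs.dim (Stab F 1) \<le> cvs.dim (Stab G 1)"
    unfolding one_regular_def by blast
  obtain G where "G \<in> U" "cvs.dim (Stab G 1) \<le> cvs.dim (Stab F0 1)"
    using generic_meets_open[OF generic_dim_Stab[OF F0 order_refl] F(2,3)] by blast
  then have "d \<le> cvs.dim (Stab F0 1)" using F by force
  moreover have "F \<in> dual" using F(2,3) by (meson openin_subset subsetD openin_imp_subset)
  ultimately show "d = cvs.dim (Stab F0 1)" using F(1) min by (simp add: antisym)
qed

section \<open>Functionals with prescribed zeros\<close>

lemma subspace_dualD:
  assumes "fun_vs.subspace \<Phi>"
  shows "0 \<in> \<Phi>" "f \<in> \<Phi> \<Longrightarrow> g \<in> \<Phi> \<Longrightarrow> f + g \<in> \<Phi>" "f \<in> \<Phi> \<Longrightarrow> (\<lambda>x. c * f x) \<in> \<Phi>"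
  using assms by (auto simp: fun_vs.subspace_def)

lemma functional_in_span_finite:
  fixes f :: "'a::fd_complex_algebra \<Rightarrow> complex"
  assumes \<Phi>: "fun_vs.subspace \<Phi>" "\<Phi> \<subseteq> dual" and "finite W" "W \<subseteq> \<Phi>" "f \<in> dual"
    and "\<And>x. (\<forall>w\<in>W. w x = 0) \<Longrightarrow> f x = 0"
  shows "f \<in> \<Phi>"
  using assms(3-6)
proof (induction W arbitrary: f rule: finite_induct)
  case empty
  then have "f = 0" by (simp add: fun_eq_iff)
  then show ?case using subspace_dualD(1)[OF \<Phi>(1)] by metis
next
  case (insert w W)
  have w: "w \<in> \<Phi>" "w \<in> dual" using insert.prems(1) \<Phi>(2) by auto
  show ?case
  proof (cases "\<exists>x. (\<forall>v\<in>W. v x = 0) \<and> w x \<noteq> 0")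
    case False
    then have "f x = 0" if "\<forall>v\<in>W. v x = 0" for x
      using that insert.prems(3)[of x] by blast
    then show ?thesis using insert.IH[of f] insert.prems(1,2) by blast
  next
    case True
    then obtain x where x: "\<forall>v\<in>W. v x = 0" "w x \<noteq> 0" by blast
    define c where "c = f x / w x"
    let ?g = "\<lambda>y. f y - c * w y"
    have "?g \<in> dual"
      using insert.prems(2) w(2) by (intro dualI) (simp_all add: dual_simps algebra_simps)
    moreover have "?g y = 0" if y: "\<forall>v\<in>W. v y = 0" for y
    proof -
      let ?z = "y - (w y / w x) *\<^sub>C x"
      have "\<forall>v\<in>insert w W. v ?z = 0"
      proof
        fix v assume v: "v \<in> insert w W"
        then have "v \<in> dual" using insert.prems(1) \<Phi>(2) by blast
        then show "v ?z = 0" using x y v by (auto simp: dual_simps)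
      qed
      then have "f ?z = 0" by (rule insert.prems(3))
      then show ?thesis using insert.prems(2) x by (simp add: dual_simps c_def)
    qed
    ultimately have "?g \<in> \<Phi>" using insert.IH[of ?g] insert.prems by blast
    then have "?g + (\<lambda>y. c * w y) \<in> \<Phi>" by (intro subspace_dualD[OF \<Phi>(1)] w)
    moreover have "?g + (\<lambda>y. c * w y) = f" by (simp add: fun_eq_iff)
    ultimately show ?thesis by simp
  qed
qed

text \<open>Double annihilators in finite dimension: finitely many elements of \<open>\<Phi>\<close> already cut out the common
  zeros of \<open>\<Phi>\<close>, namely those for which the dimension of the common zeros is least.\<close>

lemma functional_in_subspace:
  fixes f :: "'a::fd_complex_algebra \<Rightarrow> complex"
  assumes \<Phi>: "fun_vs.subspace \<Phi>" "\<Phi> \<subseteq> dual" and f: "f \<in> dual"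
    and van: "\<And>x. (\<forall>w\<in>\<Phi>. w x = 0) \<Longrightarrow> f x = 0"
  shows "f \<in> \<Phi>"
proof -
  define Z where "Z W = {x. \<forall>w\<in>W. w x = 0}" for W :: "('a \<Rightarrow> complex) set"
  obtain W where W: "finite W" "W \<subseteq> \<Phi>"
    and min: "\<And>V. finite V \<Longrightarrow> V \<subseteq> \<Phi> \<Longrightarrow> cvs.dim (Z W) \<le> cvs.dim (Z V)"
    using ex_has_least_nat[of "\<lambda>W. finite W \<and> W \<subseteq> \<Phi>" "{}" "\<lambda>W. cvs.dim (Z W)"] by auto
  have Z: "cvs.subspace (Z V)" if "V \<subseteq> \<Phi>" for V
  proof -
    have w: "w \<in> dual" if "w \<in> V" for w using that \<open>V \<subseteq> \<Phi>\<close> \<Phi>(2) by blast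
    show ?thesis by (auto simp: Z_def cvs.subspace_def dual_zero[OF w] dual_add[OF w] dual_scale[OF w])
  qed
  have "\<forall>w\<in>\<Phi>. w x = 0" if x: "x \<in> Z W" for x
  proof
    fix w assume w: "w \<in> \<Phi>"
    have "Z (insert w W) = Z W"
      using W w min[of "insert w W"] by (intro fdv.subspace_dim_equal Z) (auto simp: Z_def)
    then show "w x = 0" using x by (auto simp: Z_def)
  qed
  then show ?thesis
    using functional_in_span_finite[OF \<Phi> W f] van by (auto simp: Z_def)
qed

lemma pencil_in_dual: "F \<in> dual \<Longrightarrow> pencil F p q a \<in> dual"
  by (rule dualI)
    (simp_all add: pencil_def distrib_left distrib_right dual_simps mult_scaleC_left
      mult_scaleC_right algebra_simps)

lemma pencil_swap: "pencil F p q a x = pencil F q p x a"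
  by (simp add: pencil_def)

text \<open>The image of a bilinear form consists of all functionals vanishing on its opposite kernel.\<close>

lemma functional_represented:
  fixes f :: "'a::fd_complex_algebra \<Rightarrow> complex"
  assumes F: "F \<in> dual" and f: "f \<in> dual"
    and van: "\<And>x. (\<forall>a. pencil F p q a x = 0) \<Longrightarrow> f x = 0"
  obtains a where "f = pencil F p q a"
proof -
  have "fun_vs.subspace (range (pencil F p q))"
    by (rule form_pair.linear_subspace_image[OF linear_form_pencil[OF F] cvs.subspace_UNIV])
  moreover have "range (pencil F p q) \<subseteq> dual" using pencil_in_dual[OF F] by blast
  ultimately have "f \<in> range (pencil F p q)"
    by (rule functional_in_subspace[OF _ _ f]) (use van in auto)
  then show thesis using that by blast
qed

section \<open>The characteristic polynomial\<close>

lemma basis_expand: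
  assumes bs: "is_basis bs"
  shows "x = (\<Sum>i<length bs. cvs.representation (set bs) x (bs ! i) *\<^sub>C bs ! i)"
proof -
  have "x = (\<Sum>b\<in>set bs. cvs.representation (set bs) x b *\<^sub>C b)"
    using bs by (subst cvs.sum_representation_eq) (auto simp: is_basis_def)
  also have "\<dots> = (\<Sum>i<length bs. cvs.representation (set bs) x (bs ! i) *\<^sub>C bs ! i)"
    using bs by (intro sum.reindex_bij_betw[symmetric])
      (auto simp: is_basis_def bij_betw_nth lessThan_atLeast0)
  finally show ?thesis .
qed

lemma pencil_expand:
  assumes bs: "is_basis bs" and F: "F \<in> dual"
  shows "pencil F p q x y = (\<Sum>i<length bs. cvs.representation (set bs) x (bs ! i) * pencil F p q (bs ! i) y)"
  by (subst basis_expand[OF bs, of x])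
    (simp only: linear_form_sum[OF linear_form_pencil[OF F]] linear_form_scale[OF linear_form_pencil[OF F]])

lemma det_zero_if_left_null:
  fixes A :: "'r::idom mat"
  assumes A: "A \<in> carrier_mat n n" and w: "\<And>j. j < n \<Longrightarrow> (\<Sum>i<n. w i * A $$ (i, j)) = 0"
    and i: "i < n" "w i \<noteq> 0"
  shows "det A = 0"
proof -
  have "A\<^sup>T *\<^sub>v vec n w = 0\<^sub>v n"
    using A w by (intro eq_vecI) (auto simp: scalar_prod_def lessThan_atLeast0 mult.commute)
  moreover have "vec n w \<noteq> 0\<^sub>v n" using i by (metis index_vec index_zero_vec(1))
  ultimately have "det A\<^sup>T = 0"
    using A det_0_iff_vec_prod_zero[of "A\<^sup>T" n] by (metis transpose_carrier_mat vec_carrier)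
  then show ?thesis using A by (simp add: det_transpose)
qed

lemma gram_pencil_det_zero:
  assumes bs: "is_basis bs" and F: "F \<in> dual" and deg: "\<not> nondegenerate p q F"
  shows "det (p \<cdot>\<^sub>m gram bs F + q \<cdot>\<^sub>m (gram bs F)\<^sup>T) = 0"
proof -
  obtain a where a: "\<And>x. pencil F p q a x = 0" "a \<noteq> 0"
    using deg unfolding nondegenerate_def by blast
  have "\<exists>i<length bs. cvs.representation (set bs) a (bs ! i) \<noteq> 0"
  proof (rule ccontr)
    assume "\<not> ?thesis"
    then have "a = 0" by (subst basis_expand[OF bs]) simp
    then show False using a by simp
  qed
  then obtain i where i: "i < length bs" "cvs.representation (set bs) a (bs ! i) \<noteq> 0" by blast
  show ?thesis
  proof (rule det_zero_if_left_null[where w = "\<lambda>i. cvs.representation (set bs) a (bs ! i)"])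
    show "i < length bs" "cvs.representation (set bs) a (bs ! i) \<noteq> 0" by (rule i)+
    show "p \<cdot>\<^sub>m gram bs F + q \<cdot>\<^sub>m (gram bs F)\<^sup>T \<in> carrier_mat (length bs) (length bs)"
      by (simp add: gram_def)
    fix j assume "j < length bs"
    then have "(\<Sum>i<length bs. cvs.representation (set bs) a (bs ! i) *
        (p \<cdot>\<^sub>m gram bs F + q \<cdot>\<^sub>m (gram bs F)\<^sup>T) $$ (i, j)) = pencil F p q a (bs ! j)"
      unfolding pencil_expand[OF bs F, of p q a] by (intro sum.cong) (simp_all add: gram_def pencil_def)
    then show "(\<Sum>i<length bs. cvs.representation (set bs) a (bs ! i) *
        (p \<cdot>\<^sub>m gram bs F + q \<cdot>\<^sub>m (gram bs F)\<^sup>T) $$ (i, j)) = 0"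
      by (simp add: a)
  qed
qed

text \<open>Substituting \<open>s\<close> for \<open>\<lambda>\<close> in the characteristic polynomial; the inner variable \<open>\<mu>\<close> remains.\<close>

lemma poly_chi_basis:
  "poly (chi_basis bs F) s = det (mat (length bs) (length bs)
     (\<lambda>(i, j). s * [:F (bs ! i * bs ! j):] + [:0, 1:] * [:F (bs ! j * bs ! i):]))"
proof -
  interpret ev: comm_ring_hom "\<lambda>P. poly P s"
    by unfold_locales simp_all
  show ?thesis
    unfolding chi_basis_def Let_def ev.hom_det[symmetric]
    by (intro arg_cong[where f = det] eq_matI) (simp_all add: gram_def lam_def mu_def const_def)
qed

lemma poly_poly_chi_basis:
  "poly (poly (chi_basis bs F) s) q = det (poly s q \<cdot>\<^sub>m gram bs F + q \<cdot>\<^sub>m (gram bs F)\<^sup>T)"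
proof -
  interpret ev: comm_ring_hom "\<lambda>P. poly P q"
    by unfold_locales simp_all
  show ?thesis
    unfolding poly_chi_basis ev.hom_det[symmetric]
    by (intro arg_cong[where f = det] eq_matI) (simp_all add: gram_def)
qed

text \<open>Homogeneity of the characteristic polynomial, along the line \<open>\<lambda> = c\<mu>\<close>.\<close>

lemma poly_chi_basis_monomial:
  "poly (chi_basis bs F) [:0, c:] = [:0, 1:] ^ length bs * [:det (c \<cdot>\<^sub>m gram bs F + (gram bs F)\<^sup>T):]"
proof -
  interpret C: comm_ring_hom "\<lambda>c::complex. [:c:]"
    by unfold_locales (simp_all add: one_pCons)
  have "poly (chi_basis bs F) [:0, c:] =
      det ([:0, 1:] \<cdot>\<^sub>m map_mat (\<lambda>c. [:c:]) (c \<cdot>\<^sub>m gram bs F + (gram bs F)\<^sup>T))"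
    unfolding poly_chi_basis
    by (intro arg_cong[where f = det] eq_matI) (simp_all add: gram_def)
  also have "\<dots> = [:0, 1:] ^ length bs * [:det (c \<cdot>\<^sub>m gram bs F + (gram bs F)\<^sup>T):]"
    by (simp add: det_smult C.hom_det gram_def)
  finally show ?thesis .
qed

lemma chi_some_basis:
  obtains bs :: "'a::fd_complex_algebra list" where "is_basis bs" "chi = chi_basis bs"
  using someI_ex[OF ex_basis] by (auto simp: chi_def)

lemma is_root_if_degenerate:
  fixes F :: "'a::fd_complex_algebra \<Rightarrow> complex"
  assumes F: "F \<in> dual" and deg: "\<not> nondegenerate c 1 F"
  shows "is_root (if c = 0 then Infty else Fin (- 1 / c)) (chi F)"
proof -
  obtain bs :: "'a list" where bs: "is_basis bs" "chi = chi_basis bs" by (rule chi_some_basis)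
  have "1 \<cdot>\<^sub>m (gram bs F)\<^sup>T = (gram bs F)\<^sup>T" by auto
  then have "poly (chi F) [:0, c:] = 0"
    using gram_pencil_det_zero[OF bs(1) F deg] by (simp add: bs(2) poly_chi_basis_monomial)
  then have "[:- [:0, c:], 1:] dvd chi F" by (simp add: poly_eq_0_iff_dvd)
  then show ?thesis by (auto simp: lam_def mu_def const_def)
qed

lemma infinity_root_if_degenerate:
  fixes F :: "'a::fd_complex_algebra \<Rightarrow> complex"
  assumes F: "F \<in> dual" and deg: "\<not> nondegenerate 1 0 F"
  shows "is_root Infty (chi F)"
proof -
  obtain bs :: "'a list" where bs: "is_basis bs" "chi = chi_basis bs" by (rule chi_some_basis)
  have "det (1 \<cdot>\<^sub>m gram bs F + 0 \<cdot>\<^sub>m (gram bs F)\<^sup>T) = 0"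
    by (rule gram_pencil_det_zero[OF bs(1) F deg])
  moreover have "1 \<cdot>\<^sub>m gram bs F + 0 \<cdot>\<^sub>m (gram bs F)\<^sup>T = gram bs F"
    "0 \<cdot>\<^sub>m gram bs F + (gram bs F)\<^sup>T = (gram bs F)\<^sup>T"
    by (auto simp: gram_def)
  ultimately have "poly (chi F) [:0, 0:] = 0"
    unfolding bs(2) poly_chi_basis_monomial
    by (subst \<open>0 \<cdot>\<^sub>m gram bs F + (gram bs F)\<^sup>T = (gram bs F)\<^sup>T\<close>)
       (simp add: det_transpose[of _ "length bs"] gram_def)
  then have "[:- [:0, 0:], 1:] dvd chi F" by (simp only: poly_eq_0_iff_dvd)
  then show ?thesis by (simp add: lam_def)
qed

lemma nondegenerate_if_chi_nonzero:
  fixes F :: "'a::fd_complex_algebra \<Rightarrow> complex"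
  assumes F: "F \<in> dual" and chi: "chi F \<noteq> 0"
  obtains p q where "nondegenerate p q F"
proof -
  obtain bs :: "'a list" where bs: "is_basis bs" "chi = chi_basis bs" by (rule chi_some_basis)
  obtain s where "poly (chi F) s \<noteq> 0" using chi poly_all_0_iff_0 by blast
  then obtain q where "poly (poly (chi F) s) q \<noteq> 0" using poly_all_0_iff_0 by blast
  then have "nondegenerate (poly s q) q F"
    using gram_pencil_det_zero[OF bs(1) F] unfolding bs(2) poly_poly_chi_basis by blast
  then show thesis by (rule that)
qed

lemma one_precise_chi_nonzero: "one_precise F \<Longrightarrow> chi F \<noteq> 0"
  by (auto simp: one_precise_def Let_def)

text \<open>In a basis that begins with a basis of \<^term>\<open>Stab F 1\<close>, the first \<open>k\<close> rows of \<open>\<lambda>A + \<mu>A\<^sup>T\<close> are divisible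
  by \<open>\<lambda> + \<mu>\<close>. After division the matrix is still singular at \<open>\<lambda> = -\<mu>\<close> if some \<open>a \<noteq> 0\<close> in the stabiliser
  is orthogonal to it: then \<open>F(ay) = F(uy - yu)\<close> for some \<open>u\<close>, and this is a linear relation
  between the rows. So \<open>\<lambda> + \<mu>\<close> divides once more.\<close>

lemma one_precise_Stab_nondegenerate:
  fixes F :: "'a::fd_complex_algebra \<Rightarrow> complex"
  assumes F: "F \<in> dual" and prec: "one_precise F"
    and a: "a \<in> Stab F 1" and orth: "\<And>b. b \<in> Stab F 1 \<Longrightarrow> F (a * b) = 0"
  shows "a = 0"
proof (rule ccontr)
  assume "a \<noteq> 0"
  obtain B D where BD: "{} \<subseteq> B" "B \<subseteq> Stab F 1" "cvs.independent B" "cvs.span B = Stab F 1"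
    "B \<subseteq> D" "cvs.independent D" "cvs.span D = UNIV" "finite D"
    "card B = cvs.dim (Stab F 1)" "card D = cvs.dim (UNIV :: 'a set)"
    by (rule ex_Stab_basis[OF F, of "{}"]) (auto simp: cvs.independent_empty)
  obtain ks where ks: "set ks = B" "distinct ks"
    using finite_distinct_list[OF finite_subset[OF BD(5,8)]] by blast
  obtain ls where ls: "set ls = D - B" "distinct ls"
    using finite_distinct_list[of "D - B"] BD(8) by blast
  define bs where "bs = ks @ ls"
  define k where "k = length ks"
  define n where "n = length bs"
  have set_bs: "set bs = D" using ks ls BD(5) by (auto simp: bs_def)
  have bs: "is_basis bs"
    using set_bs BD(6,7) ks ls by (auto simp: is_basis_def bs_def)
  have k: "k = cvs.dim (Stab F 1)" using BD(9) ks by (simp add: k_def distinct_card[symmetric])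
  have kn: "k \<le> n" by (simp add: k_def n_def bs_def)
  have bs_k: "bs ! i \<in> Stab F 1" if "i < k" for i
    using that BD(2) ks by (auto simp: bs_def nth_append k_def)
  have comm_k: "F (bs ! i * x) = F (x * bs ! i)" if "i < k" for i x
    using bs_k[OF that] by (simp add: Stab_def)
  define \<alpha> where "\<alpha> i = cvs.representation (set bs) a (bs ! i)" for i
  have \<alpha>0: "\<alpha> i = 0" if "k \<le> i" "i < n" for i
  proof -
    have "cvs.representation D a = cvs.representation B a"
      using a BD(4) by (intro cvs.representation_extend[OF BD(6) _ BD(5)]) simp
    moreover have "bs ! i \<notin> B"
    proof -
      have "bs ! i = ls ! (i - k)" "i - k < length ls"
        using that by (auto simp: bs_def nth_append k_def n_def)
      then show ?thesis using ls(1) nth_mem by fastforce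
    qed
    ultimately show ?thesis
      using cvs.representation_ne_zero[of B a "bs ! i"] by (auto simp: \<alpha>_def set_bs)
  qed
  obtain i0 where i0: "i0 < n" "\<alpha> i0 \<noteq> 0"
  proof -
    have "\<exists>i<n. \<alpha> i \<noteq> 0"
    proof (rule ccontr)
      assume "\<not> ?thesis"
      then have "a = 0" unfolding \<alpha>_def n_def by (subst basis_expand[OF bs]) simp
      then show False using \<open>a \<noteq> 0\<close> by simp
    qed
    then show thesis using that by blast
  qed
  obtain u where u: "pencil F 1 0 a = pencil F 1 (-1) u"
  proof (rule functional_represented[OF F pencil_in_dual[OF F, of 1 0 a]])
    fix x assume x: "\<forall>u. pencil F 1 (-1) u x = 0"
    then have "x \<in> Stab F 1" by (auto simp: Stab_def pencil_def)
    then show "pencil F 1 0 a x = 0" using orth by (simp add: pencil_def)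
  qed
  define \<nu> where "\<nu> i = cvs.representation (set bs) u (bs ! i)" for i
  \<comment> \<open>The rows of \<open>\<lambda>A + \<mu>A\<^sup>T\<close>, the first \<open>k\<close> of them already divided by \<open>\<lambda> + \<mu>\<close>.\<close>
  define r where "r i = vec n (\<lambda>j. if i < k then const (F (bs ! i * bs ! j))
      else lam * const (F (bs ! i * bs ! j)) + mu * const (F (bs ! j * bs ! i)))" for i
  have r: "r i \<in> carrier_vec n" for i by (simp add: r_def)
  define N where "N = mat\<^sub>r n n r"
  have N: "N \<in> carrier_mat n n" by (simp add: N_def)
  have "chi_basis bs F = det (mat\<^sub>r n n (\<lambda>i. (if i < k then lam + mu else 1) \<cdot>\<^sub>v r i))"
    unfolding chi_basis_def Let_def
    by (intro arg_cong[where f = det] eq_matI)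
      (auto simp: gram_def n_def r_def comm_k distrib_right)
  also have "\<dots> = (\<Prod>i = 0..<n. if i < k then lam + mu else 1) * det N"
    unfolding N_def by (rule det_rows_mul) (use r in auto)
  also have "(\<Prod>i = 0..<n. if i < k then lam + mu else 1) = (lam + mu) ^ k"
  proof -
    have "(\<Prod>i = 0..<n. if i < k then lam + mu else 1) = (\<Prod>i = 0..<k. lam + mu)"
      using kn by (intro prod.mono_neutral_cong_right) auto
    then show ?thesis by simp
  qed
  finally have chi_N: "chi_basis bs F = (lam + mu) ^ k * det N" .
  \<comment> \<open>Divisibility of the remaining determinant by \<open>\<lambda> + \<mu>\<close> is its vanishing at \<open>\<lambda> = -\<mu>\<close>. There the rows
    with index at least \<open>k\<close> carry a factor \<open>\<mu>\<close>, which the weights of the first \<open>k\<close> rows compensate.\<close>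
  interpret ev: comm_ring_hom "\<lambda>P. poly P [:0, -1::complex:]"
    by unfold_locales simp_all
  have "poly (det N) [:0, -1:] = det (map_mat (\<lambda>P. poly P [:0, -1:]) N)"
    by (rule ev.hom_det[symmetric])
  also have "\<dots> = 0"
  proof (rule det_zero_if_left_null[where w = "\<lambda>i. if i < k then [:0, \<alpha> i:] else [:\<nu> i:]"])
    show "map_mat (\<lambda>P. poly P [:0, -1:]) N \<in> carrier_mat n n" using N by simp
    show "i0 < n" by (rule i0)
    have "i0 < k" using i0 \<alpha>0 by (meson not_le)
    then show "(if i0 < k then [:0, \<alpha> i0:] else [:\<nu> i0:]) \<noteq> 0" using i0 by simp
    fix j assume j: "j < n"
    have "(\<Sum>i<n. (if i < k then [:0, \<alpha> i:] else [:\<nu> i:]) * map_mat (\<lambda>P. poly P [:0, -1:]) N $$ (i, j))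
        = (\<Sum>i<n. [:0, \<alpha> i * pencil F 1 0 (bs ! i) (bs ! j) - \<nu> i * pencil F 1 (-1) (bs ! i) (bs ! j):])"
    proof (rule sum.cong[OF refl])
      fix i assume "i \<in> {..<n}"
      then show "(if i < k then [:0, \<alpha> i:] else [:\<nu> i:]) * map_mat (\<lambda>P. poly P [:0, -1:]) N $$ (i, j)
          = [:0, \<alpha> i * pencil F 1 0 (bs ! i) (bs ! j) - \<nu> i * pencil F 1 (-1) (bs ! i) (bs ! j):]"
        using j \<alpha>0[of i] comm_k[of i "bs ! j"]
        by (auto simp: N_def r_def const_def lam_def mu_def pencil_def algebra_simps)
    qed
    also have "\<dots> = [:0, (\<Sum>i<n. \<alpha> i * pencil F 1 0 (bs ! i) (bs ! j))
        - (\<Sum>i<n. \<nu> i * pencil F 1 (-1) (bs ! i) (bs ! j)):]"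
    proof -
      have "(\<Sum>i\<in>I. [:0, f i:]) = [:0, sum f I:]" if "finite I" for I and f :: "nat \<Rightarrow> complex"
        using that by (induction I rule: finite_induct) simp_all
      then show ?thesis by (simp add: sum_subtractf)
    qed
    also have "\<dots> = [:0, pencil F 1 0 a (bs ! j) - pencil F 1 (-1) u (bs ! j):]"
      by (simp only: pencil_expand[OF bs F, of _ _ a] pencil_expand[OF bs F, of _ _ u] \<alpha>_def \<nu>_def n_def)
    also have "\<dots> = 0" by (simp add: u)
    finally show "(\<Sum>i<n. (if i < k then [:0, \<alpha> i:] else [:\<nu> i:]) *
        map_mat (\<lambda>P. poly P [:0, -1:]) N $$ (i, j)) = 0" .
  qed
  finally have "[:- [:0, -1:], 1:] dvd det N" by (simp only: poly_eq_0_iff_dvd)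
  then have "lam + mu dvd det N" by (simp add: lam_def mu_def)
  then have "(lam + mu) ^ k * (lam + mu) dvd chi_basis bs F"
    unfolding chi_N by (rule mult_dvd_mono[OF dvd_refl])
  then have "(lam + mu) ^ Suc k dvd chi_basis bs F" by (simp add: mult.commute)
  moreover obtain c where "chi F = const c * chi_basis bs F"
  proof -
    obtain cs :: "'a list" where cs: "is_basis cs" "chi = chi_basis cs" by (rule chi_some_basis)
    show thesis using chi_basis_change[OF cs(1) bs F] that cs(2) by auto
  qed
  ultimately have "(lam + mu) ^ Suc k dvd chi F" by simp
  then show False using prec k by (simp add: one_precise_def Let_def)
qed

section \<open>Formal deformation of the stabiliser\<close>

text \<open>Identities between series over the algebra, which need not have a unit, are proved by splitting off
  the constant term.\<close>

definition fps_cons :: "'a::zero \<Rightarrow> 'a fps \<Rightarrow> 'a fps" where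
  "fps_cons c p = Abs_fps (case_nat c (fps_nth p))"

lemma fps_nth_fps_cons [simp]:
  "fps_nth (fps_cons c p) 0 = c" "fps_nth (fps_cons c p) (Suc n) = fps_nth p n"
  by (simp_all add: fps_cons_def)

lemma fps_cons_cases: obtains c p where "x = fps_cons c p"
proof
  show "x = fps_cons (fps_nth x 0) (Abs_fps (\<lambda>n. fps_nth x (Suc n)))"
    by (rule fps_ext) (simp add: fps_cons_def split: nat.split)
qed

lemma fps_cons_mult_right_nth:
  fixes p q :: "'a::ring fps"
  shows "fps_nth (q * fps_cons c p) (Suc n) = fps_nth q (Suc n) * c + fps_nth (q * p) n"
proof -
  have "(\<Sum>i = 0..n. fps_nth q i * fps_nth (fps_cons c p) (Suc n - i)) = fps_nth (q * p) n"
    unfolding fps_mult_nth by (intro sum.cong refl) (simp add: Suc_diff_le)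
  then show ?thesis
    by (simp add: fps_mult_nth[of q "fps_cons c p"] sum.atLeast0_atMost_Suc add.commute)
qed

lemma fps_cons_mult_left_nth:
  fixes p q :: "'a::ring fps"
  shows "fps_nth (fps_cons c p * q) (Suc n) = c * fps_nth q (Suc n) + fps_nth (p * q) n"
  by (simp add: fps_mult_nth sum.atLeast0_atMost_Suc_shift del: sum.cl_ivl_Suc)

text \<open>Right and left multiplication by \<open>1 + u\<close> is surjective when \<open>u\<close> has no constant term. As the algebra
  need not have a unit, \<open>1 + u\<close> itself is not available and the equations are solved coefficientwise.\<close>

lemma right_quasi_solution:
  fixes u z :: "'a::ring fps"
  assumes u: "fps_nth u 0 = 0"
  shows "\<exists>y. y + y * u = z"
proof -
  have "\<exists>f. \<forall>n. f n = fps_nth z n - (\<Sum>i<n. f i * fps_nth u (n - i))"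
    by (rule dependent_wellorder_choice) (auto intro!: sum.cong)
  then obtain f where f: "\<And>n. f n = fps_nth z n - (\<Sum>i<n. f i * fps_nth u (n - i))" by blast
  have "Abs_fps f + Abs_fps f * u = z"
  proof (rule fps_ext)
    fix n
    have "fps_nth (Abs_fps f * u) n = (\<Sum>i<n. f i * fps_nth u (n - i))"
      using u by (simp add: fps_mult_nth sum.atLeast0_atMost_Suc atLeast0AtMost
          lessThan_Suc_atMost[symmetric])
    then show "fps_nth (Abs_fps f + Abs_fps f * u) n = fps_nth z n"
      using f[of n] by simp
  qed
  then show ?thesis by blast
qed

lemma left_quasi_solution:
  fixes u z :: "'a::ring fps"
  assumes u: "fps_nth u 0 = 0"
  shows "\<exists>v. v + u * v = z"
proof -
  have "\<exists>f. \<forall>n. f n = fps_nth z n - (\<Sum>i<n. fps_nth u (n - i) * f i)"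
    by (rule dependent_wellorder_choice) (auto intro!: sum.cong)
  then obtain f where f: "\<And>n. f n = fps_nth z n - (\<Sum>i<n. fps_nth u (n - i) * f i)" by blast
  have "Abs_fps f + u * Abs_fps f = z"
  proof (rule fps_ext)
    fix n
    have "fps_nth (u * Abs_fps f) n = (\<Sum>i=0..n. fps_nth u (n - i) * f i)"
      by (subst sum.atLeastAtMost_rev) (simp add: fps_mult_nth)
    also have "\<dots> = (\<Sum>i<n. fps_nth u (n - i) * f i)"
      using u by (simp add: atLeast0AtMost lessThan_Suc_atMost[symmetric])
    finally show "fps_nth (Abs_fps f + u * Abs_fps f) n = fps_nth z n"
      using f[of n] by simp
  qed
  then show ?thesis by blast
qed

text \<open>These conditions mean that the algebra is the direct sum of the commutative subalgebra
  \<^term>\<open>Stab F 1\<close> and its orthogonal complement, and that this decomposition is one of bimodules over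
  that subalgebra.\<close>

locale split_functional =
  fixes F :: "'a::fd_complex_algebra \<Rightarrow> complex"
  assumes F: "F \<in> dual"
    and commutative: "\<And>a b. a \<in> Stab F 1 \<Longrightarrow> b \<in> Stab F 1 \<Longrightarrow> a * b = b * a"
    and nondeg: "\<And>a. a \<in> Stab F 1 \<Longrightarrow> (\<And>b. b \<in> Stab F 1 \<Longrightarrow> F (a * b) = 0) \<Longrightarrow> a = 0"
begin

lemma stab_comm: "k \<in> Stab F 1 \<Longrightarrow> F (k * x) = F (x * k)"
  by (simp add: Stab_def)

text \<open>Infinitesimal transversality: the tangent space \<open>{F([u, y])}\<close> of the coadjoint orbit and the slice
  directions \<open>{F(ky)}\<close> together are all functionals, since a common zero lies in \<^term>\<open>Stab F 1\<close> and is
  orthogonal to it.\<close>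

lemma decompose_functional:
  assumes f: "f \<in> dual"
  shows "\<exists>u k. k \<in> Stab F 1 \<and> (\<forall>y. f y = F (u * y) - F (y * u) + F (k * y))"
proof -
  define \<phi> where "\<phi> u k y = F (u * y) - F (y * u) + F (k * y)" for u k y
  define \<Phi> where "\<Phi> = {\<phi> u k | u k. k \<in> Stab F 1}"
  note K = subspace_Stab[OF F]
  note F_simps = dual_add[OF F] dual_scale[OF F] dual_zero[OF F]
  have \<phi>_mem: "\<phi> u k \<in> \<Phi>" if "k \<in> Stab F 1" for u k
    using that by (auto simp: \<Phi>_def)
  have "fun_vs.subspace \<Phi>"
    unfolding fun_vs.subspace_def
  proof (intro conjI ballI allI)
    have "\<phi> 0 0 = 0" by (simp add: fun_eq_iff \<phi>_def F_simps)
    then show "0 \<in> \<Phi>" using \<phi>_mem[OF cvs.subspace_0[OF K], of 0] by (simp only:)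
  next
    fix f g assume "f \<in> \<Phi>" "g \<in> \<Phi>"
    then obtain u k v l where *: "k \<in> Stab F 1" "l \<in> Stab F 1" "f = \<phi> u k" "g = \<phi> v l"
      unfolding \<Phi>_def by blast
    have "f + g = \<phi> (u + v) (k + l)"
      unfolding * by (simp add: fun_eq_iff \<phi>_def F_simps distrib_left distrib_right)
    then show "f + g \<in> \<Phi>" using \<phi>_mem[OF cvs.subspace_add[OF K *(1,2)]] by simp
  next
    fix c f assume "f \<in> \<Phi>"
    then obtain u k where *: "k \<in> Stab F 1" "f = \<phi> u k" unfolding \<Phi>_def by blast
    have "(\<lambda>x. c * f x) = \<phi> (c *\<^sub>C u) (c *\<^sub>C k)"
      unfolding * by (simp add: fun_eq_iff \<phi>_def F_simps mult_scaleC_left mult_scaleC_right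
          distrib_left right_diff_distrib)
    then show "(\<lambda>x. c * f x) \<in> \<Phi>" using \<phi>_mem[OF cvs.subspace_scale[OF K *(1)]] by simp
  qed
  moreover have "\<phi> u k \<in> dual" for u k
    by (rule dualI) (simp_all add: \<phi>_def F_simps distrib_left distrib_right mult_scaleC_left
        mult_scaleC_right right_diff_distrib)
  then have "\<Phi> \<subseteq> dual" unfolding \<Phi>_def by blast
  moreover have "f x = 0" if x: "\<forall>w\<in>\<Phi>. w x = 0" for x
  proof -
    have *: "\<phi> u k x = 0" if "k \<in> Stab F 1" for u k
      using x \<phi>_mem[OF that] by blast
    have "F (x * u) = F (u * x)" for u
      using *[OF cvs.subspace_0[OF K], of u] by (simp add: \<phi>_def F_simps)
    then have xK: "x \<in> Stab F 1" by (simp add: Stab_def)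
    moreover have "F (x * k) = 0" if "k \<in> Stab F 1" for k
      using *[OF that, of 0] stab_comm[OF that, of x] by (simp add: \<phi>_def F_simps)
    ultimately have "x = 0" by (rule nondeg)
    then show ?thesis using f by (simp add: dual_zero)
  qed
  ultimately have "f \<in> \<Phi>" using functional_in_subspace[OF _ _ f, of \<Phi>] by blast
  then show ?thesis unfolding \<Phi>_def \<phi>_def by blast
qed

text \<open>The equation is the coefficient of \<open>t\<^sup>n\<^sup>+\<^sup>1\<close> in
  \<open>(F + th)(y(1 + u)) = F((1 + \<kappa>)(1 + u)y)\<close> for constant \<open>y\<close>. It is solved recursively: the
  unknown coefficients enter as \<open>F([u, y]) + F(\<kappa>y)\<close>, which by \<open>decompose_functional\<close> can be any
  functional.\<close>

lemma conjugation_series: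
  assumes h: "h \<in> dual"
  obtains u \<kappa> :: "'a fps" where "fps_nth u 0 = 0" "\<And>n. fps_nth \<kappa> n \<in> Stab F 1" "fps_nth \<kappa> 0 = 0"
    "\<And>n y. F (fps_nth u (Suc n) * y) - F (y * fps_nth u (Suc n))
        + F (fps_nth (\<kappa> + \<kappa> * u) (Suc n) * y)
      = (if n = 0 then h y else 0) + h (y * fps_nth u n)"
proof -
  define P where "P f n v \<longleftrightarrow> (if n = 0 then v = (0, 0) else snd v \<in> Stab F 1 \<and>
      (\<forall>y. F (fst v * y) - F (y * fst v) + F (snd v * y) =
        (if n = 1 then h y else 0) + h (y * fst (f (n - 1)))
        - F ((\<Sum>i\<in>{0<..<n}. snd (f i) * fst (f (n - i))) * y)))"
    for f :: "nat \<Rightarrow> 'a \<times> 'a" and n v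
  have "\<exists>f. \<forall>n. P f n (f n)"
  proof (rule dependent_wellorder_choice)
    fix v n and f g :: "nat \<Rightarrow> 'a \<times> 'a"
    assume "\<And>i. i < n \<Longrightarrow> f i = g i"
    then have fg: "f (n - 1) = g (n - 1)" "(\<Sum>i\<in>{0<..<n}. snd (f i) * fst (f (n - i)))
        = (\<Sum>i\<in>{0<..<n}. snd (g i) * fst (g (n - i)))" if "n \<noteq> 0"
      using that by (auto intro!: sum.cong)
    show "P f n v = P g n v"
    proof (cases "n = 0")
      case False
      show ?thesis unfolding P_def fg[OF False] by (rule refl)
    qed (simp add: P_def)
  next
    fix n and f :: "nat \<Rightarrow> 'a \<times> 'a"
    let ?r = "\<lambda>y. (if n = 1 then h y else 0) + h (y * fst (f (n - 1)))
        - F ((\<Sum>i\<in>{0<..<n}. snd (f i) * fst (f (n - i))) * y)"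
    have "?r \<in> dual"
      using h F by (intro dualI) (auto simp: dual_simps distrib_left distrib_right
          mult_scaleC_left mult_scaleC_right algebra_simps)
    then obtain u k where "k \<in> Stab F 1" "\<forall>y. ?r y = F (u * y) - F (y * u) + F (k * y)"
      using decompose_functional by blast
    then have "n \<noteq> 0 \<Longrightarrow> P f n (u, k)" by (simp add: P_def)
    moreover have "P f 0 (0, 0)" by (simp add: P_def)
    ultimately show "\<exists>v. P f n v" by (cases "n = 0") auto
  qed
  then obtain f where f: "\<And>n. P f n (f n)" by blast
  define u where "u = Abs_fps (\<lambda>n. fst (f n))"
  define \<kappa> where "\<kappa> = Abs_fps (\<lambda>n. snd (f n))"
  have f0: "f 0 = (0, 0)" using f[of 0] by (simp add: P_def)
  show thesis
  proof
    show "fps_nth u 0 = 0" "fps_nth \<kappa> 0 = 0" using f0 by (simp_all add: u_def \<kappa>_def)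
    show "fps_nth \<kappa> n \<in> Stab F 1" for n
      using f[of n] cvs.subspace_0[OF subspace_Stab[OF F]] by (auto simp: P_def \<kappa>_def split: if_splits)
    fix n y
    have "fps_nth (\<kappa> * u) (Suc n) = (\<Sum>i\<in>{0<..<Suc n}. snd (f i) * fst (f (Suc n - i)))"
      unfolding fps_mult_nth u_def \<kappa>_def
      using f0 by (intro sum.mono_neutral_cong_right) (auto simp: not_less)
    moreover have "F (fst (f (Suc n)) * y) - F (y * fst (f (Suc n))) + F (snd (f (Suc n)) * y) =
        (if n = 0 then h y else 0) + h (y * fst (f n))
        - F ((\<Sum>i\<in>{0<..<Suc n}. snd (f i) * fst (f (Suc n - i))) * y)"
      using f[of "Suc n"] by (simp add: P_def)
    moreover have "F (fps_nth (\<kappa> + \<kappa> * u) (Suc n) * y)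
        = F (snd (f (Suc n)) * y) + F (fps_nth (\<kappa> * u) (Suc n) * y)"
      using F by (simp add: \<kappa>_def distrib_right dual_simps)
    ultimately show "F (fps_nth u (Suc n) * y) - F (y * fps_nth u (Suc n))
        + F (fps_nth (\<kappa> + \<kappa> * u) (Suc n) * y)
      = (if n = 0 then h y else 0) + h (y * fps_nth u n)"
      by (simp only: u_def fps_nth_Abs_fps add.assoc[symmetric] diff_add_cancel)
  qed
qed

text \<open>Since \<open>1 + u\<close> conjugates \<open>F + th\<close> to \<open>F((1 + \<kappa>) \<cdot>)\<close>, which is stabilised by \<open>a\<close>, the conjugate \<open>v\<close> of \<open>a\<close>,
  given by \<open>(1 + u)v = a(1 + u)\<close>, stabilises \<open>F + th\<close>. The conclusion is this statement coefficient by
  coefficient.\<close>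

lemma kernel_series:
  assumes h: "h \<in> dual" and a: "a \<in> Stab F 1"
  shows "\<exists>v. v 0 = a \<and> (\<forall>n y. pencil F 1 (-1) (v (Suc n)) y + pencil h 1 (-1) (v n) y = 0)"
proof -
  obtain u \<kappa> :: "'a fps" where u0: "fps_nth u 0 = 0" and \<kappa>: "\<And>n. fps_nth \<kappa> n \<in> Stab F 1"
    and \<kappa>0: "fps_nth \<kappa> 0 = 0"
    and gauge: "\<And>n y. F (fps_nth u (Suc n) * y) - F (y * fps_nth u (Suc n))
        + F (fps_nth (\<kappa> + \<kappa> * u) (Suc n) * y)
      = (if n = 0 then h y else 0) + h (y * fps_nth u n)"
    using conjugation_series[OF h] by metis
  \<comment> \<open>The coefficients of \<open>(F + th)(p)\<close> and of \<open>F((1 + \<kappa>)p)\<close>.\<close>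
  define H where "H p n = F (fps_nth p n) + (case n of 0 \<Rightarrow> 0 | Suc m \<Rightarrow> h (fps_nth p m))"
    for p :: "'a fps" and n
  define G where "G p n = F (fps_nth (p + \<kappa> * p) n)" for p :: "'a fps" and n
  have conj: "H (y + y * u) n = G (y + u * y) n" for y n
  proof (induction n arbitrary: y)
    case 0
    show ?case by (simp add: H_def G_def u0 \<kappa>0)
  next
    case (Suc n)
    obtain c p where y: "y = fps_cons c p" by (rule fps_cons_cases)
    have "H (y + y * u) (Suc n) = H (p + p * u) n
        + F (c * fps_nth u (Suc n)) + (if n = 0 then h c else 0) + h (c * fps_nth u n)"
      using F h u0
      by (cases n) (simp_all add: H_def y fps_cons_mult_left_nth dual_simps)
    also have "\<dots> = G (p + u * p) n + F (c * fps_nth u (Suc n))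
        + (if n = 0 then h c else 0) + h (c * fps_nth u n)"
      by (simp only: Suc.IH)
    also have "\<dots> = G (p + u * p) n + F (fps_nth u (Suc n) * c)
        + F (fps_nth (\<kappa> + \<kappa> * u) (Suc n) * c)"
      using gauge[of n c] by (simp add: algebra_simps)
    also have "\<dots> = G (y + u * y) (Suc n)"
      using F by (simp add: G_def y fps_cons_mult_right_nth dual_simps distrib_left distrib_right
          mult.assoc[symmetric])
    finally show ?case .
  qed
  let ?a = "fps_const a"
  have G_comm: "G (?a * p) n = G (p * ?a) n" for p n
  proof -
    have "F (fps_nth (\<kappa> * (?a * p)) n) = F (fps_nth (\<kappa> * (p * ?a)) n)"
      unfolding fps_mult_nth[of \<kappa>] dual_sum[OF F]
    proof (intro sum.cong refl)
      fix i
      let ?k = "fps_nth \<kappa> i" and ?x = "fps_nth p (n - i)"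
      have "F (?k * (a * ?x)) = F (a * (?k * ?x))"
        using commutative[OF \<kappa> a, of i] by (metis mult.assoc)
      also have "\<dots> = F (?k * (?x * a))"
        using stab_comm[OF a, of "?k * ?x"] by (simp add: mult.assoc)
      finally show "F (?k * fps_nth (?a * p) (n - i)) = F (?k * fps_nth (p * ?a) (n - i))"
        by simp
    qed
    then show ?thesis using F stab_comm[OF a] by (simp add: G_def dual_simps)
  qed
  obtain v where v: "v + u * v = ?a + ?a * u"
    using left_quasi_solution[OF u0] by blast
  have comm: "H (v * z) n = H (z * v) n" for z n
  proof -
    obtain y where z: "z = y + y * u"
      using right_quasi_solution[OF u0, of z] by metis
    have "H (v * z) n = H (v * y + v * y * u) n"
      by (simp add: z distrib_left mult.assoc)
    also have "\<dots> = G (v * y + u * (v * y)) n" by (rule conj)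
    also have "v * y + u * (v * y) = (v + u * v) * y"
      by (simp add: distrib_right mult.assoc)
    also have "\<dots> = ?a * (y + u * y)"
      unfolding v by (simp add: distrib_right distrib_left mult.assoc)
    also have "G \<dots> n = G ((y + u * y) * ?a) n" by (rule G_comm)
    also have "(y + u * y) * ?a = y * ?a + u * (y * ?a)"
      by (simp add: distrib_right mult.assoc)
    also have "G \<dots> n = H (y * ?a + y * ?a * u) n" by (rule conj[symmetric])
    also have "y * ?a + y * ?a * u = y * (v + u * v)"
      unfolding v by (simp add: distrib_left mult.assoc)
    also have "\<dots> = z * v"
      by (simp add: z distrib_right distrib_left mult.assoc)
    finally show ?thesis .
  qed
  have "fps_nth v 0 = a"
    using arg_cong[OF v, of "\<lambda>p. fps_nth p 0"] u0 by simp
  moreover have "pencil F 1 (-1) (fps_nth v (Suc n)) y + pencil h 1 (-1) (fps_nth v n) y = 0" for n y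
    using comm[of "fps_const y" "Suc n"] by (simp add: H_def pencil_def algebra_simps)
  ultimately show ?thesis by blast
qed

text \<open>Let \<open>X\<close>, \<open>Z\<close> be the skew forms of \<open>F\<close>, \<open>H\<close> and \<open>W\<close> the span of all coefficients of the series from
  \<open>kernel_series\<close> for \<open>h = H - F\<close>. The recursion shows \<open>Z W \<subseteq> X W\<close>, so on \<open>W\<close> the form \<open>Z\<close> has at least
  as large a kernel as \<open>X\<close>, and \<open>W\<close> contains the whole kernel of \<open>X\<close>.\<close>

theorem dim_Stab_minimal:
  fixes H :: "'a \<Rightarrow> complex"
  assumes H: "H \<in> dual"
  shows "cvs.dim (Stab F 1) \<le> cvs.dim (Stab H 1)"
proof -
  let ?K = "Stab F 1"
  define h where "h x = H x - F x" for x
  have h: "h \<in> dual"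
    using F H by (intro dualI) (simp_all add: h_def dual_simps algebra_simps)
  obtain v where v: "\<And>a. a \<in> ?K \<Longrightarrow> v a 0 = a"
    "\<And>a n y. a \<in> ?K \<Longrightarrow> pencil F 1 (-1) (v a (Suc n)) y + pencil h 1 (-1) (v a n) y = 0"
    using kernel_series[OF h] by metis
  define S where "S = {v a n | a n. a \<in> ?K}"
  let ?W = "cvs.span S"
  let ?X = "pencil F 1 (-1)" and ?Z = "pencil H 1 (-1)"
  note X = linear_form_pencil[OF F, of 1 "-1"] and Z = linear_form_pencil[OF H, of 1 "-1"]
  have XW: "fun_vs.subspace (?X ` ?W)"
    by (rule form_pair.linear_subspace_image[OF X cvs.subspace_span])
  have "?Z x \<in> ?X ` ?W" if "x \<in> S" for x
  proof -
    obtain a n where x: "x = v a n" "a \<in> ?K" using \<open>x \<in> S\<close> S_def by blast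
    let ?w = "v a n - v a (Suc n)"
    have "?w \<in> ?W" using x(2) by (intro cvs.span_diff cvs.span_base) (auto simp: S_def)
    moreover have "?Z x = ?X ?w"
    proof
      fix y
      have "?Z x y = ?X x y + pencil h 1 (-1) x y"
        by (simp add: pencil_def h_def algebra_simps)
      also have "\<dots> = ?X x y - ?X (v a (Suc n)) y"
        using v(2)[OF x(2), of n y] x(1) by (simp add: add_eq_0_iff)
      also have "\<dots> = ?X ?w y"
        using F x(1) by (simp add: pencil_def dual_simps algebra_simps)
      finally show "?Z x y = ?X ?w y" .
    qed
    ultimately show ?thesis by blast
  qed
  then have "?Z ` ?W \<subseteq> ?X ` ?W"
    using form_pair.linear_span_image[OF Z, of S] XW
    by (metis fun_vs.span_minimal image_subsetI)
  then have "fun_vs.dim (?Z ` ?W) \<le> fun_vs.dim (?X ` ?W)"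
    by (rule form_pair.dim_image_mono[OF X])
  then have "cvs.dim {x \<in> ?W. ?X x = 0} \<le> cvs.dim {x \<in> ?W. ?Z x = 0}"
    using form_pair.dim_kernel_image[OF X cvs.subspace_span, of S]
      form_pair.dim_kernel_image[OF Z cvs.subspace_span, of S] by linarith
  moreover have "?K \<subseteq> {x \<in> ?W. ?X x = 0}"
  proof
    fix a assume a: "a \<in> ?K"
    have "v a 0 \<in> S" using a unfolding S_def by blast
    then have "a \<in> S" by (simp only: v(1)[OF a])
    then show "a \<in> {x \<in> ?W. ?X x = 0}" using a by (auto simp: Stab_pencil cvs.span_base)
  qed
  moreover have "{x \<in> ?W. ?Z x = 0} \<subseteq> Stab H 1" by (auto simp: Stab_pencil)
  ultimately show ?thesis
    by (meson fdv.dim_subset order_trans)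
qed

end

section \<open>Eigenvectors\<close>

text \<open>The vector \<open>p(Z)x\<close>, by Horner's scheme.\<close>

definition poly_apply :: "('c \<Rightarrow> 'c::complex_algebra) \<Rightarrow> complex poly \<Rightarrow> 'c \<Rightarrow> 'c" where
  "poly_apply Z p x = fold_coeffs (\<lambda>c y. c *\<^sub>C x + Z y) p 0"

text \<open>A nonzero polynomial \<open>q\<close> of least degree with \<open>q(Z)x = 0\<close> has a root \<open>\<beta>\<close>; dividing \<open>q\<close> by the linear
  factor of \<open>\<beta>\<close> gives the eigenvector, which lies in \<open>N\<close> like every \<open>p(Z)x\<close>.\<close>

lemma eigenvector_exists:
  fixes Z :: "'c::fd_complex_algebra \<Rightarrow> 'c"
  assumes Z: "Vector_Spaces.linear (*\<^sub>C) (*\<^sub>C) Z" and N: "cvs.subspace N"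
    and inv: "\<And>x. x \<in> N \<Longrightarrow> Z x \<in> N" and "x \<in> N" "x \<noteq> 0"
  obtains \<beta> y where "y \<in> N" "y \<noteq> 0" "Z y = \<beta> *\<^sub>C y"
proof -
  interpret Z: Vector_Spaces.linear "(*\<^sub>C)" "(*\<^sub>C)" Z by (rule Z)
  let ?e = "\<lambda>p. poly_apply Z p x"
  have e_0: "?e 0 = 0" by (simp add: poly_apply_def)
  have e_pCons: "?e (pCons c p) = c *\<^sub>C x + Z (?e p)" for c p
  proof (cases "p = 0 \<and> c = 0")
    case True
    then show ?thesis by (simp add: e_0)
  next
    case False
    then show ?thesis by (auto simp: poly_apply_def fold_coeffs_def cCons_def)
  qed
  have e_add: "?e (p + q) = ?e p + ?e q" for p q
    by (induction p q rule: poly_induct2)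
      (simp_all add: e_0 e_pCons Z.add cvs.scale_left_distrib)
  have e_smult: "?e (smult c p) = c *\<^sub>C ?e p" for c p
    by (induction p) (simp_all add: e_0 e_pCons Z.scale cvs.scale_right_distrib)
  have e_N: "?e p \<in> N" for p
    by (induction p) (use N inv \<open>x \<in> N\<close> in \<open>auto simp: e_0 e_pCons cvs.subspace_0
        intro!: cvs.subspace_add cvs.subspace_scale\<close>)
  have e_sum: "?e (\<Sum>i\<in>I. f i) = (\<Sum>i\<in>I. ?e (f i))" for I and f :: "nat \<Rightarrow> complex poly"
    by (induction I rule: infinite_finite_induct) (simp_all add: e_0 e_add)
  obtain p where p: "p \<noteq> 0" "?e p = 0"
  proof -
    let ?n = "cvs.dim (UNIV :: 'c set)"
    let ?v = "\<lambda>i. ?e (monom 1 i)"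
    show thesis
    proof (cases "inj_on ?v {..?n}")
      case False
      then obtain i j where "i \<noteq> j" "?v i = ?v j" by (auto simp: inj_on_def)
      then have "?e (monom 1 i + smult (-1) (monom 1 j)) = 0"
        by (simp add: e_add e_smult del: smult_minus_left)
      moreover have "monom 1 i + smult (-1) (monom 1 j) \<noteq> (0 :: complex poly)"
        using \<open>i \<noteq> j\<close> by (simp add: poly_eq_iff) (metis one_neq_zero diff_0_right)
      ultimately show thesis by (intro that)
    next
      case True
      then have "card (?v ` {..?n}) = Suc ?n" by (simp add: card_image)
      then have "cvs.dependent (?v ` {..?n})"
        using fdv.independent_card_le_dim[of "?v ` {..?n}" UNIV] by force
      then obtain u where u: "\<exists>v\<in>?v ` {..?n}. u v \<noteq> 0" "(\<Sum>v\<in>?v ` {..?n}. u v *\<^sub>C v) = 0"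
        by (auto simp: cvs.dependent_finite)
      let ?p = "\<Sum>i\<le>?n. smult (u (?v i)) (monom 1 i)"
      have "?e ?p = 0"
        using u(2) by (simp add: e_sum e_smult sum.reindex[OF True])
      moreover have "coeff ?p i = u (?v i)" if "i \<le> ?n" for i
        using that by (simp add: coeff_sum if_distrib cong: if_cong)
      then have "?p \<noteq> 0" using u(1) by force
      ultimately show thesis by (intro that)
    qed
  qed
  have "\<exists>p. p \<noteq> 0 \<and> ?e p = 0" using p by blast
  then obtain q where q: "q \<noteq> 0" "?e q = 0"
    and min: "\<And>p. p \<noteq> 0 \<Longrightarrow> ?e p = 0 \<Longrightarrow> degree q \<le> degree p"
    using ex_has_least_nat[of "\<lambda>p. p \<noteq> 0 \<and> ?e p = 0" p degree] p by blast
  have "degree q \<noteq> 0"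
  proof
    assume "degree q = 0"
    then obtain c where "q = [:c:]" by (rule degree_eq_zeroE)
    then show False using q \<open>x \<noteq> 0\<close> e_pCons[of c 0] by (simp add: e_0)
  qed
  then obtain \<beta> where "poly q \<beta> = 0"
    using fundamental_theorem_of_algebra[of q] constant_degree[of q] by auto
  then obtain s where s: "q = [:- \<beta>, 1:] * s" by (auto simp: poly_eq_0_iff_dvd elim: dvdE)
  have "s \<noteq> 0" using q s by auto
  then have "degree q = degree [:- \<beta>, 1:] + degree s"
    unfolding s by (intro degree_mult_eq) simp_all
  then have "degree s < degree q" by simp
  then have "?e s \<noteq> 0" using min \<open>s \<noteq> 0\<close> by force
  moreover have "q = smult (- \<beta>) s + pCons 0 s" using s by simp
  then have "Z (?e s) = \<beta> *\<^sub>C ?e s"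
    using q(2) by (simp add: e_add e_smult e_pCons del: smult_minus_left)
  ultimately show thesis using that e_N by blast
qed

section \<open>The tensor product\<close>

lemma tensor_induct [case_names tens zero add scale]:
  assumes "\<And>a b. P (tens a b)" "P 0" "\<And>S T. P S \<Longrightarrow> P T \<Longrightarrow> P (S + T)"
    "\<And>c T. P T \<Longrightarrow> P (c *\<^sub>C T)"
  shows "P T"
proof -
  have sum: "P (\<Sum>x\<in>I. f x)" if "\<And>x. P (f x)" for I :: "('a \<times> 'b) set" and f
    using that by (induction I rule: infinite_finite_induct) (auto intro: assms)
  obtain p where T: "T = (\<Sum>x\<in>keys p. lookup p x *\<^sub>C tens (fst x) (snd x))"
    using tensor_induct_expand[of T] by blast
  show ?thesis
    unfolding T by (intro sum assms)
qed

text \<open>The universal property of the tensor product.\<close>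

lemma tensor_lift:
  fixes \<beta> :: "'a::complex_algebra \<Rightarrow> 'b::complex_algebra \<Rightarrow> 'c::complex_algebra"
  assumes left: "\<And>a a' b. \<beta> (a + a') b = \<beta> a b + \<beta> a' b" "\<And>c a b. \<beta> (c *\<^sub>C a) b = c *\<^sub>C \<beta> a b"
    and right: "\<And>a b b'. \<beta> a (b + b') = \<beta> a b + \<beta> a b'" "\<And>c a b. \<beta> a (c *\<^sub>C b) = c *\<^sub>C \<beta> a b"
  obtains f where "Vector_Spaces.linear (*\<^sub>C) (*\<^sub>C) f" "\<And>a b. f (tens a b) = \<beta> a b"
proof -
  define L where "L p = (\<Sum>x\<in>keys p. lookup p x *\<^sub>C \<beta> (fst x) (snd x))" for p :: "'a \<times> 'b \<Rightarrow>\<^sub>0 complex"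
  have L: "L p = (\<Sum>x\<in>S. lookup p x *\<^sub>C \<beta> (fst x) (snd x))" if "finite S" "keys p \<subseteq> S" for p S
    unfolding L_def using that by (intro sum.mono_neutral_left) (auto simp: in_keys_iff)
  have L_add: "L (p + q) = L p + L q" for p q
    using keys_add[of p q]
    by (subst (1 2 3) L[of "keys p \<union> keys q"])
      (auto simp: lookup_add cvs.scale_left_distrib sum.distrib)
  have L_scale: "L (fscale c p) = c *\<^sub>C L p" for c p
    using keys_fscale[of c p] by (subst (1 2) L[of "keys p"]) (auto simp: cvs.scale_sum_right)
  have L_diff: "L (p - q) = L p - L q" for p q
    using L_add[of "p - q" q] by simp
  have L_single: "L (single (a, b) c) = c *\<^sub>C \<beta> a b" for a b c
    by (subst L[of "{(a, b)}"]) auto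
  have L_null: "L p = 0" if "p \<in> tensor_null" for p
    using that unfolding tensor_null_def
  proof (induction rule: free_vs.span_induct)
    case base
    have "L 0 = 0" by (simp add: L_def)
    then show ?case by (simp add: free_vs.subspace_def L_add L_scale)
  next
    case (step r)
    then show ?case
      unfolding tensor_relators_def by (auto simp: L_diff L_scale L_single left right)
  qed
  define f where "f T = L (rep_tensor T)" for T
  have f_abs: "f (abs_tensor p) = L p" for p
  proof -
    have "tensor_rel (rep_tensor (abs_tensor p)) p"
      using Quotient3_tensor equivp_tensor_rel by (metis Quotient3_def tensor.abs_eq_iff)
    then have "L (rep_tensor (abs_tensor p) - p) = 0" by (simp add: tensor_rel_def L_null)
    then show ?thesis by (simp add: L_diff f_def)
  qed
  show thesis
  proof
    have "f (S + T) = f S + f T" for S T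
      by (induction S rule: tensor.abs_induct, induction T rule: tensor.abs_induct)
        (simp add: plus_tensor.abs_eq f_abs L_add)
    moreover have "f (c *\<^sub>C T) = c *\<^sub>C f T" for c T
      by (induction T rule: tensor.abs_induct) (simp add: scaleC_tensor.abs_eq f_abs L_scale)
    ultimately show "Vector_Spaces.linear (*\<^sub>C) (*\<^sub>C) f" by unfold_locales auto
    show "f (tens a b) = \<beta> a b" for a b
      by (simp add: tens.abs_eq f_abs L_single)
  qed
qed

lemma tens_zero_left [simp]: "tens 0 b = 0" and tens_zero_right [simp]: "tens a 0 = 0"
  using tens_scaleC_left[of 0 0 b] tens_scaleC_right[of a 0 0] by simp_all

lemma tens_sum_right: "tens a (sum g I) = (\<Sum>i\<in>I. tens a (g i))"
  by (induction I rule: infinite_finite_induct) (simp_all add: tens_add_right)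

text \<open>The map \<open>1 \<otimes> g\<close> from the tensor product to its first factor. Tensors are studied through their slices
  throughout, which reduces statements about them to statements about the factors.\<close>

definition slice :: "('b::fd_complex_algebra \<Rightarrow> complex) \<Rightarrow> ('a::fd_complex_algebra, 'b) tensor \<Rightarrow> 'a" where
  "slice g = (SOME f. Vector_Spaces.linear (*\<^sub>C) (*\<^sub>C) f \<and> (\<forall>a b. f (tens a b) = g b *\<^sub>C a))"

lemma
  fixes g :: "'b::fd_complex_algebra \<Rightarrow> complex"
  assumes g: "g \<in> dual"
  shows linear_slice: "Vector_Spaces.linear (*\<^sub>C) (*\<^sub>C) (slice g :: ('a::fd_complex_algebra, 'b) tensor \<Rightarrow> 'a)"
    and slice_tens: "slice g (tens a b) = g b *\<^sub>C (a :: 'a)"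
proof -
  obtain f :: "('a, 'b) tensor \<Rightarrow> 'a" where "Vector_Spaces.linear (*\<^sub>C) (*\<^sub>C) f" "\<And>a b. f (tens a b) = g b *\<^sub>C a"
    by (rule tensor_lift[of "\<lambda>a b. g b *\<^sub>C a"])
      (auto simp: cvs.scale_right_distrib cvs.scale_left_distrib dual_simps[OF g] mult.commute)
  then have "\<exists>f :: ('a, 'b) tensor \<Rightarrow> 'a. Vector_Spaces.linear (*\<^sub>C) (*\<^sub>C) f \<and> (\<forall>a b. f (tens a b) = g b *\<^sub>C a)"
    by blast
  from someI_ex[OF this] show "Vector_Spaces.linear (*\<^sub>C) (*\<^sub>C) (slice g :: ('a, 'b) tensor \<Rightarrow> 'a)"
    "slice g (tens a b) = g b *\<^sub>C (a :: 'a)"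
    unfolding slice_def by blast+
qed

lemma slice_add: "g \<in> dual \<Longrightarrow> slice g (S + T) = slice g S + slice g T"
  using linear_slice unfolding Vector_Spaces.linear_iff by blast

lemma slice_scale: "g \<in> dual \<Longrightarrow> slice g (c *\<^sub>C T) = c *\<^sub>C slice g T"
  using linear_slice unfolding Vector_Spaces.linear_iff by blast

lemma slice_zero: "g \<in> dual \<Longrightarrow> slice g 0 = 0"
  using slice_scale[of g 0 0] by simp

lemma slice_diff: "g \<in> dual \<Longrightarrow> slice g (S - T) = slice g S - slice g T"
  using slice_add[of g "S - T" T] by simp

lemma slice_sum: "g \<in> dual \<Longrightarrow> slice g (sum f I) = (\<Sum>i\<in>I. slice g (f i))"
  by (induction I rule: infinite_finite_induct) (simp_all add: slice_zero slice_add)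

lemma dual_combination: "(\<lambda>x. c * f x + d * g x) \<in> dual" if "f \<in> dual" "g \<in> dual"
  by (rule dualI) (simp_all add: dual_add[OF that(1)] dual_add[OF that(2)]
      dual_scale[OF that(1)] dual_scale[OF that(2)] algebra_simps)

lemma slice_combination:
  assumes f: "f \<in> dual" and g: "g \<in> dual"
  shows "slice (\<lambda>x. c * f x + d * g x) T = c *\<^sub>C slice f T + d *\<^sub>C slice g T"
proof -
  define k where "k x = c * f x + d * g x" for x
  have k: "k \<in> dual" unfolding k_def by (rule dual_combination[OF f g])
  have "slice k T = c *\<^sub>C slice f T + d *\<^sub>C slice g T"
  proof (induction T rule: tensor_induct)
    case (tens a b)
    show ?case
      unfolding slice_tens[OF k] slice_tens[OF f] slice_tens[OF g]
      unfolding k_def by (simp add: cvs.scale_left_distrib)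
  next
    case (scale e T)
    then show ?case
      by (simp add: slice_scale[OF k] slice_scale[OF f] slice_scale[OF g] cvs.scale_right_distrib
          mult.commute)
  qed (simp_all add: slice_zero[OF k] slice_zero[OF f] slice_zero[OF g] slice_add[OF k]
      slice_add[OF f] slice_add[OF g] cvs.scale_right_distrib)
  then show ?thesis unfolding k_def .
qed

lemma representation_in_dual:
  assumes "cvs.independent D" "cvs.span D = UNIV"
  shows "(\<lambda>b. cvs.representation D b e) \<in> dual"
  unfolding dual_def mem_Collect_eq using assms by (rule cvs.linear_representation)

lemma slice_expand:
  fixes T :: "('a::fd_complex_algebra, 'b::fd_complex_algebra) tensor"
  assumes D: "cvs.independent D" "cvs.span D = UNIV" "finite D"
  shows "(\<Sum>e\<in>D. tens (slice (\<lambda>b. cvs.representation D b e) T) e) = T"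
proof (induction T rule: tensor_induct)
  case (tens a b)
  have "(\<Sum>e\<in>D. tens (slice (\<lambda>b. cvs.representation D b e) (tens a b)) e)
      = tens a (\<Sum>e\<in>D. cvs.representation D b e *\<^sub>C e)"
    unfolding slice_tens[OF representation_in_dual[OF D(1,2)]] tens_sum_right
      tens_scaleC_left tens_scaleC_right by (rule refl)
  also have "(\<Sum>e\<in>D. cvs.representation D b e *\<^sub>C e) = b"
    using D by (intro cvs.sum_representation_eq) auto
  finally show ?case .
next
  case zero
  show ?case unfolding slice_zero[OF representation_in_dual[OF D(1,2)]] tens_zero_left by simp
next
  case (add S T)
  then show ?case
    unfolding slice_add[OF representation_in_dual[OF D(1,2)]] tens_add_left sum.distrib by simp
next
  case (scale c T)
  then show ?case
    unfolding slice_scale[OF representation_in_dual[OF D(1,2)]] tens_scaleC_left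
      cvs.scale_sum_right[symmetric] by simp
qed

lemma tensor_zero_if_slices_zero:
  fixes T :: "('a::fd_complex_algebra, 'b::fd_complex_algebra) tensor"
  assumes "\<And>g. g \<in> dual \<Longrightarrow> slice g T = 0"
  shows "T = 0"
proof -
  obtain bs :: "'b list" where "is_basis bs" using ex_basis by blast
  then have bs: "cvs.independent (set bs)" "cvs.span (set bs) = UNIV" "finite (set bs)"
    by (simp_all add: is_basis_def)
  have "(\<Sum>e\<in>set bs. tens (slice (\<lambda>b. cvs.representation (set bs) b e) T) e) = 0"
    by (simp only: assms[OF representation_in_dual[OF bs(1,2)]] tens_zero_left sum.neutral_const)
  then show ?thesis by (simp only: slice_expand[OF bs])
qed

text \<open>The functional \<open>F \<otimes> G\<close>.\<close>

definition functional_tensor :: "('a::fd_complex_algebra \<Rightarrow> complex) \<Rightarrow> ('b::fd_complex_algebra \<Rightarrow> complex) \<Rightarrow>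
    ('a, 'b) tensor \<Rightarrow> complex" where
  "functional_tensor F G T = F (slice G T)"

lemma functional_tensor_in_dual:
  assumes F: "F \<in> dual" and G: "G \<in> dual"
  shows "functional_tensor F G \<in> dual"
  by (rule dualI) (simp_all add: functional_tensor_def slice_add[OF G] slice_scale[OF G]
      dual_add[OF F] dual_scale[OF F])

lemma dual_mult_right: "(\<lambda>b. G (b * y)) \<in> dual" if G: "G \<in> dual"
  by (rule dualI) (simp_all only: distrib_right dual_add[OF G] mult_scaleC_left dual_scale[OF G])

lemma dual_mult_left: "(\<lambda>b. G (y * b)) \<in> dual" if G: "G \<in> dual"
  by (rule dualI) (simp_all only: distrib_left dual_add[OF G] mult_scaleC_right dual_scale[OF G])

lemma functional_tensor_mult_right:
  assumes F: "F \<in> dual" and G: "G \<in> dual"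
  shows "functional_tensor F G (T * tens x y) = F (slice (\<lambda>b. G (b * y)) T * x)"
proof -
  note g = dual_mult_right[OF G, of y]
  note simps = slice_add[OF g] slice_scale[OF g] slice_zero[OF g] slice_tens[OF g]
    slice_add[OF G] slice_scale[OF G] slice_zero[OF G] slice_tens[OF G]
    dual_add[OF F] dual_scale[OF F] dual_zero[OF F]
  show ?thesis
    unfolding functional_tensor_def
    by (induction T rule: tensor_induct)
      (simp_all add: simps tens_mult distrib_right mult_scaleC_left)
qed

lemma functional_tensor_mult_left:
  assumes F: "F \<in> dual" and G: "G \<in> dual"
  shows "functional_tensor F G (tens x y * T) = F (x * slice (\<lambda>b. G (y * b)) T)"
proof -
  note g = dual_mult_left[OF G, of y]
  note simps = slice_add[OF g] slice_scale[OF g] slice_zero[OF g] slice_tens[OF g]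
    slice_add[OF G] slice_scale[OF G] slice_zero[OF G] slice_tens[OF G]
    dual_add[OF F] dual_scale[OF F] dual_zero[OF F]
  show ?thesis
    unfolding functional_tensor_def
    by (induction T rule: tensor_induct)
      (simp_all add: simps tens_mult distrib_left mult_scaleC_right)
qed

lemma Stab_functional_tensor_iff:
  assumes F: "F \<in> dual" and G: "G \<in> dual"
  shows "T \<in> Stab (functional_tensor F G) 1 \<longleftrightarrow>
    (\<forall>x y. F (slice (\<lambda>b. G (b * y)) T * x) = F (x * slice (\<lambda>b. G (y * b)) T))"
proof -
  note FG = functional_tensor_in_dual[OF F G]
  have "functional_tensor F G (T * S) = functional_tensor F G (S * T)"
    if "\<forall>x y. functional_tensor F G (T * tens x y) = functional_tensor F G (tens x y * T)" for S
  proof (induction S rule: tensor_induct)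
    case (tens a b)
    show ?case using that by blast
  next
    case (add S S')
    then show ?case by (simp only: distrib_left distrib_right dual_add[OF FG])
  next
    case (scale c S)
    then show ?case by (simp only: mult_scaleC_left mult_scaleC_right dual_scale[OF FG])
  qed simp
  then have "T \<in> Stab (functional_tensor F G) 1 \<longleftrightarrow>
      (\<forall>x y. functional_tensor F G (T * tens x y) = functional_tensor F G (tens x y * T))"
    unfolding Stab_def mem_Collect_eq mult_1 by blast
  then show ?thesis
    by (simp only: functional_tensor_mult_right[OF F G] functional_tensor_mult_left[OF F G])
qed

section \<open>Commutativity of minimal stabilisers\<close>

lemma dual_separates:
  fixes x :: "'a::fd_complex_algebra"
  assumes "\<And>h. h \<in> dual \<Longrightarrow> h x = 0"
  shows "x = 0"
proof -
  obtain bs :: "'a list" where bs: "is_basis bs" using ex_basis by blast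
  then have "cvs.representation (set bs) x b = 0" for b
    by (intro assms[OF representation_in_dual]) (simp_all add: is_basis_def)
  then show ?thesis by (subst basis_expand[OF bs]) simp
qed

text \<open>Suppose \<open>h([a, b]) \<noteq> 0\<close> for a functional \<open>h\<close>. Let \<open>L\<close> be spanned by a complement of \<^term>\<open>Stab F 1\<close> and
  \<open>a\<close>. The functional \<open>h([a, \<cdot>])\<close> does not vanish at \<open>b\<close>, whereas every \<open>F([x, \<cdot>])\<close> vanishes there. So for
  almost all \<open>t\<close> the skew form of \<open>F + th\<close> is injective on \<open>L\<close>, and its rank exceeds that of \<open>F\<close>.\<close>

lemma Stab_commutative_if_minimal:
  fixes F :: "'a::fd_complex_algebra \<Rightarrow> complex"
  assumes F: "F \<in> dual"
    and min: "\<And>H :: 'a \<Rightarrow> complex. H \<in> dual \<Longrightarrow> cvs.dim (Stab F 1) \<le> cvs.dim (Stab H 1)"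
    and a: "a \<in> Stab F 1" and b: "b \<in> Stab F 1"
  shows "a * b = b * a"
proof -
  have "h (a * b - b * a) = 0" if h: "h \<in> dual" for h
  proof (rule ccontr)
    assume ne: "h (a * b - b * a) \<noteq> 0"
    then have "a \<noteq> 0" using h by (auto simp: dual_zero)
    obtain B D where BD: "{a} \<subseteq> B" "B \<subseteq> Stab F 1" "cvs.independent B" "cvs.span B = Stab F 1"
      "B \<subseteq> D" "cvs.independent D" "cvs.span D = UNIV" "finite D"
      "card B = cvs.dim (Stab F 1)" "card D = cvs.dim (UNIV :: 'a set)"
      by (rule ex_Stab_basis[OF F, of "{a}"]) (use a \<open>a \<noteq> 0\<close> in auto)
    let ?L = "cvs.span (insert a (D - B))"
    let ?X = "pencil F 1 (-1)" and ?Y = "pencil h 1 (-1)"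
    note X = linear_form_pencil[OF F, of 1 "-1"] and Y = linear_form_pencil[OF h, of 1 "-1"]
    \<comment> \<open>At \<open>t = 0\<close> the form of \<open>F + th\<close> kills \<open>a\<close>. Rescaling the component \<open>\<pi> v\<close> along \<open>a\<close> by \<open>1/t\<close> leads to
      the pencil with terms \<open>X v + Y(\<pi> v)\<close> and \<open>Y(v - \<pi> v)\<close>, which is already injective at \<open>0\<close>.\<close>
    define \<pi> where "\<pi> v = cvs.representation D v a *\<^sub>C a" for v
    note rep = representation_in_dual[OF BD(6,7), of a]
    have \<pi>_add: "\<pi> (v + w) = \<pi> v + \<pi> w" and \<pi>_scale: "\<pi> (c *\<^sub>C v) = c *\<^sub>C \<pi> v" for v w c
      by (simp_all add: \<pi>_def dual_add[OF rep] dual_scale[OF rep] cvs.scale_left_distrib)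
    have aD: "a \<in> D" using BD(1,5) by auto
    have \<pi>_a: "\<pi> a = a"
      using cvs.representation_basis[OF BD(6) aD] by (simp add: \<pi>_def)
    have \<pi>_l: "\<pi> l = 0" if "l \<in> cvs.span (D - B)" for l
    proof -
      have "cvs.representation D l a = cvs.representation (D - B) l a"
        using cvs.representation_extend[OF BD(6) that] by simp
      also have "\<dots> = 0"
        using cvs.representation_ne_zero[of "D - B" l a] BD(1) by auto
      finally show ?thesis by (simp add: \<pi>_def)
    qed
    have split: "v - \<pi> v \<in> cvs.span (D - B)" if v: "v \<in> ?L" for v
    proof -
      obtain k where k: "v - k *\<^sub>C a \<in> cvs.span (D - B)"
        using v by (auto simp: cvs.span_insert)
      have "\<pi> v = \<pi> (v - k *\<^sub>C a) + \<pi> (k *\<^sub>C a)"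
        by (simp only: \<pi>_add[symmetric] diff_add_cancel)
      also have "\<dots> = k *\<^sub>C a" using \<pi>_l[OF k] by (simp add: \<pi>_scale \<pi>_a)
      finally show ?thesis using k by simp
    qed
    have X_a: "?X (c *\<^sub>C a) y = 0" for c y
      unfolding linear_form_scale[OF X] using a by (simp add: pencil_def Stab_def)
    have X_\<pi>: "?X (\<pi> v) y = 0" for v y unfolding \<pi>_def by (rule X_a)
    have X_split: "?X v y = ?X (v - \<pi> v) y" for v y
      using linear_form_add[OF X, of "v - \<pi> v" "\<pi> v" y] X_\<pi> by simp
    have Y_split: "?Y v y = ?Y (v - \<pi> v) y + ?Y (\<pi> v) y" for v y
      using linear_form_add[OF Y, of "v - \<pi> v" "\<pi> v" y] by simp
    have XY: "linear_form (\<lambda>v y. ?X v y + ?Y (\<pi> v) y)"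
      by (rule linear_formI) (simp_all add: \<pi>_add \<pi>_scale linear_form_add[OF X] linear_form_scale[OF X]
          linear_form_add[OF Y] linear_form_scale[OF Y] distrib_left)
    have diff_add: "v + w - \<pi> (v + w) = (v - \<pi> v) + (w - \<pi> w)"
      and diff_scale: "c *\<^sub>C v - \<pi> (c *\<^sub>C v) = c *\<^sub>C (v - \<pi> v)" for v w c
      by (simp_all add: \<pi>_add \<pi>_scale cvs.scale_right_diff_distrib)
    have YL: "linear_form (\<lambda>v y. ?Y (v - \<pi> v) y)"
      by (rule linear_formI) (simp_all only: diff_add diff_scale linear_form_add[OF Y] linear_form_scale[OF Y])
    have inj0: "v = 0" if v: "v \<in> ?L" and z: "\<And>y. ?X v y + ?Y (\<pi> v) y + 0 * ?Y (v - \<pi> v) y = 0" for v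
    proof -
      have "?X v b = 0" using b by (simp add: pencil_def Stab_def)
      then have "?Y (\<pi> v) b = 0" using z[of b] by simp
      then have "cvs.representation D v a * h (a * b - b * a) = 0"
        unfolding \<pi>_def linear_form_scale[OF Y] by (simp add: pencil_def dual_diff[OF h])
      then have \<pi>0: "\<pi> v = 0" using ne by (simp add: \<pi>_def)
      have Y0: "?Y (\<pi> v) y = 0" for y
        unfolding \<pi>0 using linear_form_scale[OF Y, of 0 0 y] by simp
      have "?X (v - \<pi> v) y = 0" for y
        unfolding X_split[symmetric] using z[of y] Y0[of y] by simp
      then have "v - \<pi> v = 0"
        by (rule Stab_complement[OF F BD(2-7) split[OF v]])
      then show "v = 0" using \<pi>0 by simp
    qed
    have "finite {t. \<exists>v\<in>?L. v \<noteq> 0 \<and> (\<forall>y. ?X v y + ?Y (\<pi> v) y + t * ?Y (v - \<pi> v) y = 0)}"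
      by (rule pencil_injective_cofinite[OF XY YL cvs.subspace_span inj0])
    then have "finite (insert 0 {t. \<exists>v\<in>?L. v \<noteq> 0 \<and> (\<forall>y. ?X v y + ?Y (\<pi> v) y + t * ?Y (v - \<pi> v) y = 0)})"
      by simp
    from ex_new_if_finite[OF infinite_UNIV_char_0 this]
    obtain t where t': "t \<notin> insert 0 {t. \<exists>v\<in>?L. v \<noteq> 0 \<and>
        (\<forall>y. ?X v y + ?Y (\<pi> v) y + t * ?Y (v - \<pi> v) y = 0)}"
      by blast
    then have "t \<noteq> 0" by blast
    have t: "v = 0" if "v \<in> ?L" "\<And>y. ?X v y + ?Y (\<pi> v) y + t * ?Y (v - \<pi> v) y = 0" for v
      using t' that by blast
    define H where "H x = F x + t * h x" for x
    have H: "H \<in> dual"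
      by (rule dualI) (simp_all add: H_def dual_add[OF F] dual_add[OF h] dual_scale[OF F]
          dual_scale[OF h] algebra_simps)
    have XH: "pencil H 1 (-1) v y = ?X v y + t * ?Y v y" for v y
      by (simp add: pencil_def H_def algebra_simps)
    have "cvs.dim (Stab H 1) + cvs.dim ?L \<le> cvs.dim (UNIV :: 'a set)"
    proof (rule dim_Stab_le_if_injective[OF H cvs.subspace_span])
      fix v assume v: "v \<in> ?L" and z: "\<And>y. pencil H 1 (-1) v y = 0"
      let ?l = "v - \<pi> v" and ?z = "(v - \<pi> v) + t *\<^sub>C \<pi> v"
      have l: "?l \<in> cvs.span (D - B)" by (rule split[OF v])
      have "\<pi> (\<pi> v) = \<pi> v" by (simp add: \<pi>_def[of v] \<pi>_scale \<pi>_a)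
      then have \<pi>z: "\<pi> ?z = t *\<^sub>C \<pi> v" using \<pi>_l[OF l] by (simp add: \<pi>_add \<pi>_scale)
      have "?l \<in> ?L" using l cvs.span_mono[of "D - B" "insert a (D - B)"] by blast
      moreover have "\<pi> v \<in> ?L"
        unfolding \<pi>_def by (intro cvs.span_scale cvs.span_base insertI1)
      ultimately have "?z \<in> ?L" by (rule cvs.span_add[OF _ cvs.span_scale])
      moreover have "?X ?z y + ?Y (\<pi> ?z) y + t * ?Y (?z - \<pi> ?z) y = 0" for y
      proof -
        have "?X ?z y = ?X v y"
          by (subst X_split[of v]) (simp add: linear_form_add[OF X] linear_form_scale[OF X] X_\<pi>)
        then have "?X ?z y + ?Y (\<pi> ?z) y + t * ?Y (?z - \<pi> ?z) y = pencil H 1 (-1) v y"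
          unfolding XH by (subst Y_split[of v])
            (simp add: \<pi>z linear_form_scale[OF Y] distrib_left)
        then show ?thesis using z by simp
      qed
      ultimately have "?z = 0" by (rule t)
      then have "\<pi> ?z = 0" using \<pi>_scale[of 0 0] by (simp only: cvs.scale_zero_left)
      then have "\<pi> v = 0" using \<open>t \<noteq> 0\<close> \<pi>z by simp
      then show "v = 0" using \<open>?z = 0\<close> by simp
    qed
    moreover have "cvs.dim ?L = Suc (card D - card B)"
    proof -
      have "insert a (D - B) \<subseteq> D" using aD by auto
      then have "cvs.independent (insert a (D - B))"
        using BD(6) cvs.independent_mono by blast
      then have "cvs.dim ?L = card (insert a (D - B))"
        by (rule cvs.dim_span_eq_card_independent)
      also have "\<dots> = Suc (card (D - B))" using BD(1,8) by simp
      also have "card (D - B) = card D - card B"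
        using BD(5,8) by (simp add: card_Diff_subset finite_subset)
      finally show ?thesis .
    qed
    ultimately show False
      using min[OF H] BD(9,10) card_mono[OF BD(8,5)] by simp
  qed
  then have "a * b - b * a = 0" by (rule dual_separates)
  then show ?thesis by simp
qed

section \<open>The stabiliser of a product functional\<close>

text \<open>The Nakayama map of a nondegenerate functional.\<close>

lemma nakayama_exists:
  fixes F :: "'a::fd_complex_algebra \<Rightarrow> complex"
  assumes F: "F \<in> dual" and left: "nondegenerate 1 0 F" and right: "nondegenerate 0 1 F"
  obtains M where "Vector_Spaces.linear (*\<^sub>C) (*\<^sub>C) M" "\<And>a x. F (x * a) = F (M a * x)"
proof -
  have "\<exists>m. \<forall>x. F (x * a) = F (m * x)" for a
  proof -
    obtain m where "pencil F 0 1 a = pencil F 1 0 m"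
    proof (rule functional_represented[OF F pencil_in_dual[OF F, of 0 1 a], of 1 0])
      fix x assume "\<forall>c. pencil F 1 0 c x = 0"
      then have "\<forall>c. pencil F 0 1 x c = 0" by (simp add: pencil_swap[of F 0 1])
      then have "x = 0" using right unfolding nondegenerate_def by blast
      then show "pencil F 0 1 a x = 0" by (simp add: pencil_def dual_zero[OF F])
    qed
    then show ?thesis by (auto simp: pencil_def fun_eq_iff)
  qed
  then obtain M where M: "\<And>a x. F (x * a) = F (M a * x)" by metis
  have unique: "m = n" if "\<And>x. F (m * x) = F (n * x)" for m n
  proof -
    have "\<forall>x. pencil F 1 0 (m - n) x = 0"
      using that by (simp add: pencil_def left_diff_distrib dual_diff[OF F])
    then have "m - n = 0" using left unfolding nondegenerate_def by blast
    then show ?thesis by simp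
  qed
  have "M (a + b) = M a + M b" for a b
    by (rule unique) (simp add: M[symmetric] distrib_left distrib_right dual_add[OF F])
  moreover have "M (c *\<^sub>C a) = c *\<^sub>C M a" for c a
    by (rule unique) (simp add: M[symmetric] mult_scaleC_left mult_scaleC_right dual_scale[OF F])
  ultimately have "Vector_Spaces.linear (*\<^sub>C) (*\<^sub>C) M" by unfold_locales auto
  then show thesis using that M by blast
qed

text \<open>Together the two conclusions say that the stabiliser of \<open>F \<otimes> G\<close> is contained in the tensor product of
  the stabilisers. By \<open>disjoint\<close> the map \<open>M \<otimes> 1\<close>, written \<open>Z\<close>, has no eigenvalue except 1 on the
  stabiliser \<open>N\<close>. If \<open>(Z - 1)N\<close> were nonzero it would contain an eigenvector, whose slices lie both in
  \<^term>\<open>Stab F 1\<close> and in the image of \<open>M - 1\<close>; but that image is orthogonal to \<^term>\<open>Stab F 1\<close>.\<close>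

lemma Stab_functional_tensor_slices:
  fixes F :: "'a::fd_complex_algebra \<Rightarrow> complex" and G :: "'b::fd_complex_algebra \<Rightarrow> complex"
  assumes split_F: "split_functional F" and G: "G \<in> dual"
    and left: "nondegenerate 1 0 F" and right: "nondegenerate 0 1 F"
    and disjoint: "\<forall>\<beta>. \<beta> \<noteq> 1 \<longrightarrow> nondegenerate (- \<beta>) 1 F \<or> nondegenerate 1 (- \<beta>) G"
    and T: "T \<in> Stab (functional_tensor F G) 1"
  shows "g \<in> dual \<Longrightarrow> slice g T \<in> Stab F 1" and "slice (pencil G 1 (-1) y) T = 0"
proof -
  note F = split_functional.F[OF split_F]
  obtain M where M: "Vector_Spaces.linear (*\<^sub>C) (*\<^sub>C) M" and FM: "\<And>a x. F (x * a) = F (M a * x)"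
    by (rule nakayama_exists[OF F left right]) blast
  interpret M: Vector_Spaces.linear "(*\<^sub>C)" "(*\<^sub>C)" M by (rule M)
  obtain Z :: "('a, 'b) tensor \<Rightarrow> ('a, 'b) tensor" where
    Z: "Vector_Spaces.linear (*\<^sub>C) (*\<^sub>C) Z" and Z_tens: "\<And>a b. Z (tens a b) = tens (M a) b"
    by (rule tensor_lift[of "\<lambda>a b. tens (M a) b"])
      (auto simp: M.add M.scale tens_add_left tens_add_right tens_scaleC_left tens_scaleC_right)
  interpret Z: Vector_Spaces.linear "(*\<^sub>C)" "(*\<^sub>C)" Z by (rule Z)
  have slice_Z: "slice g (Z S) = M (slice g S)" if "g \<in> dual" for g S
    by (induction S rule: tensor_induct)
      (simp_all add: Z_tens Z.add Z.scale M.add M.scale slice_add[OF that] slice_scale[OF that]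
        slice_zero[OF that] slice_tens[OF that])
  let ?N = "Stab (functional_tensor F G) 1"
  note subN = subspace_Stab[OF functional_tensor_in_dual[OF F G]]
  have N_iff: "S \<in> ?N \<longleftrightarrow> (\<forall>y. slice (\<lambda>b. G (b * y)) S = M (slice (\<lambda>b. G (y * b)) S))" for S
  proof
    assume S: "S \<in> ?N"
    show "\<forall>y. slice (\<lambda>b. G (b * y)) S = M (slice (\<lambda>b. G (y * b)) S)"
    proof
      fix y
      let ?d = "slice (\<lambda>b. G (b * y)) S - M (slice (\<lambda>b. G (y * b)) S)"
      have "F (slice (\<lambda>b. G (b * y)) S * x) = F (M (slice (\<lambda>b. G (y * b)) S) * x)" for x
        using S FM[of x "slice (\<lambda>b. G (y * b)) S"] unfolding Stab_functional_tensor_iff[OF F G] by simp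
      then have "\<forall>x. pencil F 1 0 ?d x = 0"
        by (simp add: pencil_def left_diff_distrib dual_diff[OF F])
      then have "?d = 0" using left unfolding nondegenerate_def by blast
      then show "slice (\<lambda>b. G (b * y)) S = M (slice (\<lambda>b. G (y * b)) S)" by simp
    qed
  next
    assume S: "\<forall>y. slice (\<lambda>b. G (b * y)) S = M (slice (\<lambda>b. G (y * b)) S)"
    show "S \<in> ?N"
      unfolding Stab_functional_tensor_iff[OF F G]
    proof (intro allI)
      fix x y
      show "F (slice (\<lambda>b. G (b * y)) S * x) = F (x * slice (\<lambda>b. G (y * b)) S)"
        using spec[OF S, of y] FM[of x "slice (\<lambda>b. G (y * b)) S"] by simp
    qed
  qed
  have Z_N: "Z S \<in> ?N" if "S \<in> ?N" for S
    using that unfolding N_iff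
    by (simp add: slice_Z[OF dual_mult_right[OF G]] slice_Z[OF dual_mult_left[OF G]])
  have slice_pencil: "slice (pencil G p q y) S
      = p *\<^sub>C slice (\<lambda>b. G (y * b)) S + q *\<^sub>C slice (\<lambda>b. G (b * y)) S" for p q y S
    unfolding slice_combination[OF dual_mult_left[OF G] dual_mult_right[OF G], symmetric]
    by (intro arg_cong2[where f = slice] refl) (simp add: pencil_def fun_eq_iff)
  \<comment> \<open>An eigenvalue \<open>\<beta>\<close> makes the slices eigenvectors of \<open>M\<close>, so that \<open>F\<close> is degenerate at \<open>(-\<beta>, 1)\<close>, unless
    \<open>G\<close> is degenerate at \<open>(1, -\<beta>)\<close>; both at once are excluded for \<open>\<beta> \<noteq> 1\<close>.\<close>
  have eigen: "\<beta> = 1" if S: "S \<in> ?N" "S \<noteq> 0" and ev: "Z S = \<beta> *\<^sub>C S" for S \<beta>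
  proof (rule ccontr)
    assume "\<beta> \<noteq> 1"
    have M_slice: "M (slice g S) = \<beta> *\<^sub>C slice g S" if "g \<in> dual" for g
      using slice_Z[OF that, of S] by (simp add: ev slice_scale[OF that])
    have "slice g S = 0" if g: "g \<in> dual" for g
      using disjoint[rule_format, OF \<open>\<beta> \<noteq> 1\<close>]
    proof
      assume nd: "nondegenerate (- \<beta>) 1 F"
      have "\<forall>x. pencil F (- \<beta>) 1 (slice g S) x = 0"
        by (simp add: pencil_def FM[of _ "slice g S"] M_slice[OF g] mult_scaleC_left dual_scale[OF F])
      then show ?thesis using nd unfolding nondegenerate_def by blast
    next
      assume nd: "nondegenerate 1 (- \<beta>) G"
      obtain y where y: "g = pencil G (- \<beta>) 1 y"
      proof (rule functional_represented[OF G g, of "- \<beta>" 1])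
        fix x assume "\<forall>y. pencil G (- \<beta>) 1 y x = 0"
        then have "\<forall>y. pencil G 1 (- \<beta>) x y = 0" by (simp add: pencil_swap[of G 1])
        then have "x = 0" using nd unfolding nondegenerate_def by blast
        then show "g x = 0" using dual_zero[OF g] by simp
      qed
      have "slice (\<lambda>b. G (b * y)) S = \<beta> *\<^sub>C slice (\<lambda>b. G (y * b)) S"
        using S(1) M_slice[OF dual_mult_left[OF G]] unfolding N_iff by simp
      then show ?thesis by (simp add: y slice_pencil)
    qed
    then show False using S(2) tensor_zero_if_slices_zero by blast
  qed
  have fixed_Stab: "m \<in> Stab F 1" if "M m = m" for m
  proof -
    have "F (m * x) = 1 * F (x * m)" for x
      using FM[of x m] that by simp
    then show ?thesis unfolding Stab_def by blast
  qed
  have Z_id: "Z S = S" if S: "S \<in> ?N" for S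
  proof (rule ccontr)
    assume "Z S \<noteq> S"
    let ?N' = "(\<lambda>S. Z S - S) ` ?N"
    have "cvs.subspace ?N'"
      unfolding cvs.subspace_def
    proof (intro conjI ballI allI)
      show "0 \<in> ?N'"
        using cvs.subspace_0[OF subN] Z.zero by (intro image_eqI[of _ _ 0]) auto
    next
      fix x y assume "x \<in> ?N'" "y \<in> ?N'"
      then obtain u v where "u \<in> ?N" "v \<in> ?N" "x = Z u - u" "y = Z v - v" by blast
      then show "x + y \<in> ?N'"
        using cvs.subspace_add[OF subN] by (intro image_eqI[of _ _ "u + v"]) (auto simp: Z.add)
    next
      fix c x assume "x \<in> ?N'"
      then obtain u where "u \<in> ?N" "x = Z u - u" by blast
      then show "c *\<^sub>C x \<in> ?N'"
        using cvs.subspace_scale[OF subN]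
        by (intro image_eqI[of _ _ "c *\<^sub>C u"]) (auto simp: Z.scale cvs.scale_right_diff_distrib)
    qed
    moreover have "Z x \<in> ?N'" if "x \<in> ?N'" for x
      using that Z_N by (auto simp: Z.diff)
    moreover have "Z S - S \<in> ?N'" "Z S - S \<noteq> 0" using S \<open>Z S \<noteq> S\<close> by auto
    ultimately obtain \<beta> R where R: "R \<in> ?N'" "R \<noteq> 0" "Z R = \<beta> *\<^sub>C R"
      by (rule eigenvector_exists[OF Z, of ?N'])
    then obtain Q where Q: "Q \<in> ?N" "R = Z Q - Q" by blast
    have "R \<in> ?N" using Q Z_N cvs.subspace_diff[OF subN] by simp
    then have "Z R = R" using eigen R by (metis cvs.scale_one)
    have "slice g R = 0" if g: "g \<in> dual" for g
    proof (rule split_functional.nondeg[OF split_F])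
      show "slice g R \<in> Stab F 1"
        using slice_Z[OF g, of R] \<open>Z R = R\<close> by (intro fixed_Stab) simp
      fix k assume k: "k \<in> Stab F 1"
      have "slice g R = M (slice g Q) - slice g Q"
        by (simp add: Q(2) slice_diff[OF g] slice_Z[OF g])
      then have "F (slice g R * k) = F (k * slice g Q) - F (slice g Q * k)"
        by (simp add: left_diff_distrib dual_diff[OF F] FM[of k "slice g Q"])
      then show "F (slice g R * k) = 0" using k by (simp add: Stab_def)
    qed
    then show False using R(2) tensor_zero_if_slices_zero by blast
  qed
  show "slice g T \<in> Stab F 1" if g: "g \<in> dual"
    using slice_Z[OF g, of T] Z_id[OF T] by (intro fixed_Stab) simp
  have "M (slice (\<lambda>b. G (y * b)) T) = slice (\<lambda>b. G (y * b)) T"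
    using slice_Z[OF dual_mult_left[OF G], of y T] Z_id[OF T] by simp
  then show "slice (pencil G 1 (-1) y) T = 0"
    using T unfolding N_iff by (simp add: slice_pencil)
qed

lemma dim_span_tens:
  fixes A :: "'a::fd_complex_algebra set" and B :: "'b::fd_complex_algebra set"
  assumes A: "cvs.independent A" and B: "cvs.independent B"
  shows "cvs.dim (cvs.span ((\<lambda>(a, b). tens a b) ` (A \<times> B))) = card A * card B"
proof -
  obtain D where D: "B \<subseteq> D" "cvs.independent D" "cvs.span D = UNIV"
  proof (rule cvs.maximal_independent_subset_extend[OF subset_UNIV B])
    fix D assume "B \<subseteq> D" "cvs.independent D" "UNIV \<subseteq> cvs.span D"
    then show thesis by (intro that top_le)
  qed
  have fin: "finite A" "finite B"
    by (rule fdv.finiteI_independent[OF A], rule fdv.finiteI_independent[OF B])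
  note dual = representation_in_dual[OF D(2,3)]
  have ind: "\<forall>p\<in>A \<times> B. c p = 0" if sum0: "(\<Sum>p\<in>A \<times> B. c p *\<^sub>C (\<lambda>(a, b). tens a b) p) = 0" for c
  proof clarify
    fix a b assume ab: "a \<in> A" "b \<in> B"
    let ?s = "slice (\<lambda>x. cvs.representation D x b)"
    have rep: "cvs.representation D x b = (if x = b then 1 else 0)" if "x \<in> B" for x
      using cvs.representation_basis[OF D(2) subsetD[OF D(1) that]] by (simp add: eq_commute)
    have "0 = ?s (\<Sum>p\<in>A \<times> B. c p *\<^sub>C (\<lambda>(a, b). tens a b) p)"
      unfolding sum0 slice_zero[OF dual] by (rule refl)
    also have "\<dots> = (\<Sum>a\<in>A. \<Sum>x\<in>B. (c (a, x) * cvs.representation D x b) *\<^sub>C a)"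
      by (simp add: slice_sum[OF dual] slice_scale[OF dual] slice_tens[OF dual] case_prod_beta
          sum.cartesian_product)
    also have "\<dots> = (\<Sum>a\<in>A. c (a, b) *\<^sub>C a)"
    proof (rule sum.cong[OF refl])
      fix a
      have "(\<Sum>x\<in>B. (c (a, x) * cvs.representation D x b) *\<^sub>C a)
          = (\<Sum>x\<in>{b}. (c (a, x) * cvs.representation D x b) *\<^sub>C a)"
        using fin ab rep by (intro sum.mono_neutral_right) auto
      also have "\<dots> = c (a, b) *\<^sub>C a" using rep[OF ab(2)] by simp
      finally show "(\<Sum>x\<in>B. (c (a, x) * cvs.representation D x b) *\<^sub>C a) = c (a, b) *\<^sub>C a" .
    qed
    finally show "c (a, b) = 0"
      using cvs.independentD[OF A fin(1) order_refl, of "\<lambda>a. c (a, b)" a] ab(1) by simp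
  qed
  have "finite (A \<times> B)" using fin by simp
  note family = independent_family[where v = "\<lambda>(a, b). tens a b", OF this]
  have inj: "inj_on (\<lambda>(a, b). tens a b) (A \<times> B)"
    by (rule family(1)) (rule ind)
  have "cvs.independent ((\<lambda>(a, b). tens a b) ` (A \<times> B))"
    by (rule family(2)) (rule ind)
  then have "cvs.dim (cvs.span ((\<lambda>(a, b). tens a b) ` (A \<times> B))) = card ((\<lambda>(a, b). tens a b) ` (A \<times> B))"
    by (rule cvs.dim_span_eq_card_independent)
  also have "\<dots> = card (A \<times> B)" by (rule card_image[OF inj])
  also have "\<dots> = card A * card B" by (rule card_cartesian_product)
  finally show ?thesis .
qed

text \<open>Both defining properties pass to \<open>F \<otimes> G\<close> because its stabiliser is exactly the span of the elementary
  tensors of elements of the two stabilisers.\<close>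

lemma split_functional_tensor:
  fixes F :: "'a::fd_complex_algebra \<Rightarrow> complex" and G :: "'b::fd_complex_algebra \<Rightarrow> complex"
  assumes "split_functional F" and "split_functional G"
    and left: "nondegenerate 1 0 F" and right: "nondegenerate 0 1 F"
    and disjoint: "\<forall>\<beta>. \<beta> \<noteq> 1 \<longrightarrow> nondegenerate (- \<beta>) 1 F \<or> nondegenerate 1 (- \<beta>) G"
  shows "split_functional (functional_tensor F G)"
    and "cvs.dim (Stab (functional_tensor F G) 1) = cvs.dim (Stab F 1) * cvs.dim (Stab G 1)"
proof -
  interpret F: split_functional F by fact
  interpret G: split_functional G by fact
  let ?N = "Stab (functional_tensor F G) 1"
  note FG = functional_tensor_in_dual[OF F.F G.F]
  note subN = subspace_Stab[OF FG]
  note slices = Stab_functional_tensor_slices[OF assms(1) G.F left right disjoint]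
  obtain A A' where A: "A \<subseteq> Stab F 1" "cvs.independent A" "cvs.span A = Stab F 1"
    "card A = cvs.dim (Stab F 1)"
    by (rule ex_Stab_basis[OF F.F, of "{}"]) (auto simp: cvs.independent_empty)
  obtain B D where B: "B \<subseteq> Stab G 1" "cvs.independent B" "cvs.span B = Stab G 1"
    "card B = cvs.dim (Stab G 1)" and D: "B \<subseteq> D" "cvs.independent D" "cvs.span D = UNIV" "finite D"
    by (rule ex_Stab_basis[OF G.F, of "{}"]) (auto simp: cvs.independent_empty)
  let ?E = "(\<lambda>(a, b). tens a b) ` (A \<times> B)"
  have tens_N: "tens k l \<in> ?N" if k: "k \<in> Stab F 1" and l: "l \<in> Stab G 1" for k l
    unfolding Stab_functional_tensor_iff[OF F.F G.F] slice_tens[OF dual_mult_right[OF G.F]]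
      slice_tens[OF dual_mult_left[OF G.F]]
    using k l by (simp add: mult_scaleC_left mult_scaleC_right dual_scale[OF F.F] Stab_def)
  have tens_span: "tens k l \<in> cvs.span ?E" if k: "k \<in> Stab F 1" and l: "l \<in> B" for k l
  proof -
    have "k \<in> cvs.span A" using k A(3) by simp
    then show ?thesis
    proof (induction rule: cvs.span_induct_alt)
      case base
      show ?case by (simp add: cvs.span_zero)
    next
      case (step c x y)
      then have "tens x l \<in> ?E" using l by force
      then show ?case
        unfolding tens_add_left tens_scaleC_left
        using step(2) by (rule cvs.span_add[OF cvs.span_scale[OF cvs.span_base]])
    qed
  qed
  have expand: "T = (\<Sum>e\<in>B. tens (slice (\<lambda>b. cvs.representation D b e) T) e)" if T: "T \<in> ?N" for T
  proof -
    have "slice (\<lambda>b. cvs.representation D b e) T = 0" if e: "e \<in> D - B" for e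
    proof -
      obtain y where y: "(\<lambda>b. cvs.representation D b e) = pencil G 1 (-1) y"
      proof (rule functional_represented[OF G.F representation_in_dual[OF D(2,3), of e], of 1 "-1"])
        fix x assume x: "\<forall>y. pencil G 1 (-1) y x = 0"
        then have "x \<in> Stab G 1" by (auto simp: Stab_def pencil_def)
        then have "cvs.representation D x = cvs.representation B x"
          using B(3) by (intro cvs.representation_extend[OF D(2) _ D(1)]) simp
        then show "cvs.representation D x e = 0"
          using e cvs.representation_ne_zero[of B x e] by auto
      qed
      show ?thesis unfolding y by (rule slices(2)[OF T])
    qed
    then have "(\<Sum>e\<in>D. tens (slice (\<lambda>b. cvs.representation D b e) T) e)
        = (\<Sum>e\<in>B. tens (slice (\<lambda>b. cvs.representation D b e) T) e)"
      using D(1,4) by (intro sum.mono_neutral_right) auto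
    then show ?thesis using slice_expand[OF D(2-4), of T] by simp
  qed
  have N_span: "?N = cvs.span ?E"
  proof
    show "cvs.span ?E \<subseteq> ?N"
      using A(1) B(1) by (intro cvs.span_minimal subN) (auto intro!: tens_N)
    show "?N \<subseteq> cvs.span ?E"
    proof
      fix T assume T: "T \<in> ?N"
      have "(\<Sum>e\<in>B. tens (slice (\<lambda>b. cvs.representation D b e) T) e) \<in> cvs.span ?E"
        by (intro cvs.span_sum tens_span slices(1)[OF T] representation_in_dual[OF D(2,3)])
      then show "T \<in> cvs.span ?E" using expand[OF T] by simp
    qed
  qed
  show "cvs.dim ?N = cvs.dim (Stab F 1) * cvs.dim (Stab G 1)"
    unfolding N_span dim_span_tens[OF A(2) B(2)] A(4) B(4) by (rule refl)
  show "split_functional (functional_tensor F G)"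
  proof
    show "functional_tensor F G \<in> dual" by (rule FG)
  next
    fix S T assume S: "S \<in> ?N" and T: "T \<in> ?N"
    have comm1: "tens k l * T = T * tens k l" if k: "k \<in> Stab F 1" and l: "l \<in> Stab G 1" for k l
    proof -
      have "tens k l * U = U * tens k l" if "U \<in> cvs.span ?E" for U
        using that
      proof (induction rule: cvs.span_induct_alt)
        case (step c x y)
        then obtain a b where ab: "a \<in> A" "b \<in> B" "x = tens a b" by auto
        then have "k * a = a * k" "l * b = b * l"
          using A(1) B(1) k l F.commutative G.commutative by blast+
        then show ?case using step(2) ab
          by (simp add: tens_mult distrib_left distrib_right mult_scaleC_left mult_scaleC_right)
      qed simp
      then show ?thesis using T N_span by blast
    qed
    have "U * T = T * U" if "U \<in> cvs.span ?E" for U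
      using that
    proof (induction rule: cvs.span_induct_alt)
      case (step c x y)
      then obtain a b where ab: "a \<in> A" "b \<in> B" "x = tens a b" by auto
      then have "x * T = T * x" using A(1) B(1) comm1 by blast
      then show ?case using step(2)
        by (simp add: distrib_left distrib_right mult_scaleC_left mult_scaleC_right)
    qed simp
    then show "S * T = T * S" using S N_span by blast
  next
    fix T assume T: "T \<in> ?N" and orth: "\<And>S. S \<in> ?N \<Longrightarrow> functional_tensor F G (T * S) = 0"
    have zero: "slice (\<lambda>b. G (b * l)) T = 0" if l: "l \<in> Stab G 1" for l
    proof (rule F.nondeg)
      show "slice (\<lambda>b. G (b * l)) T \<in> Stab F 1"
        by (rule slices(1)[OF T dual_mult_right[OF G.F]])
      fix k assume "k \<in> Stab F 1"
      then show "F (slice (\<lambda>b. G (b * l)) T * k) = 0"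
        using orth[OF tens_N[OF _ l]] by (simp add: functional_tensor_mult_right[OF F.F G.F])
    qed
    show "T = 0"
    proof (rule tensor_zero_if_slices_zero)
      fix g :: "'b \<Rightarrow> complex" assume "g \<in> dual"
      then obtain u k where k: "k \<in> Stab G 1" and g: "\<And>y. g y = G (u * y) - G (y * u) + G (k * y)"
        using G.decompose_functional by blast
      have "g = (\<lambda>b. 1 * pencil G 1 (-1) u b + 1 * G (b * k))"
        using G.stab_comm[OF k] by (simp add: fun_eq_iff g pencil_def)
      then have "slice g T = 1 *\<^sub>C slice (pencil G 1 (-1) u) T + 1 *\<^sub>C slice (\<lambda>b. G (b * k)) T"
        by (simp only: slice_combination[OF pencil_in_dual[OF G.F] dual_mult_right[OF G.F]])
      then show "slice g T = 0" by (simp add: slices(2)[OF T] zero[OF k])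
    qed
  qed
qed

section \<open>Choice of functionals\<close>

lemma ex_minimal_functional:
  obtains F :: "'a::fd_complex_algebra \<Rightarrow> complex" where "F \<in> dual"
    "\<And>H :: 'a \<Rightarrow> complex. H \<in> dual \<Longrightarrow> cvs.dim (Stab F 1) \<le> cvs.dim (Stab H 1)"
  using ex_has_least_nat[of "\<lambda>F :: 'a \<Rightarrow> complex. F \<in> dual" "\<lambda>_. 0" "\<lambda>F. cvs.dim (Stab F 1)"]
    dual_zero_fun by auto

lemma generic_ind:
  "generic (\<lambda>F :: 'a::fd_complex_algebra \<Rightarrow> complex. cvs.dim (Stab F 1) \<le> ind TYPE('a))"
proof -
  obtain F :: "'a \<Rightarrow> complex" where "F \<in> dual"
    "\<And>H :: 'a \<Rightarrow> complex. H \<in> dual \<Longrightarrow> cvs.dim (Stab F 1) \<le> cvs.dim (Stab H 1)"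
    by (rule ex_minimal_functional) blast
  then show ?thesis using ind_eq generic_dim_Stab by (metis order_refl)
qed

lemma ind_le_dim_Stab:
  fixes H :: "'a::fd_complex_algebra \<Rightarrow> complex"
  assumes "H \<in> dual"
  shows "ind TYPE('a) \<le> cvs.dim (Stab H 1)"
proof -
  obtain F :: "'a \<Rightarrow> complex" where "F \<in> dual"
    "\<And>H :: 'a \<Rightarrow> complex. H \<in> dual \<Longrightarrow> cvs.dim (Stab F 1) \<le> cvs.dim (Stab H 1)"
    by (rule ex_minimal_functional) blast
  then show ?thesis using ind_eq assms by metis
qed

text \<open>A generic functional in the open set of 1-precise ones has minimal stabiliser, hence a commutative one.\<close>

lemma ex_split_functional:
  fixes C :: "('a::fd_complex_algebra \<Rightarrow> complex) \<Rightarrow> bool"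
  assumes "one_precise_alg TYPE('a)" and C: "generic C"
  obtains F :: "'a \<Rightarrow> complex" where "split_functional F" "one_precise F" "C F"
    "cvs.dim (Stab F 1) = ind TYPE('a)"
proof -
  obtain U :: "('a \<Rightarrow> complex) set" where U: "open_in_dual U" "dual \<subseteq> closure U" "\<forall>F\<in>U. one_precise F"
    using assms(1) unfolding one_precise_alg_def by blast
  have "U \<noteq> {}" using U(2) dual_zero_fun by auto
  then obtain F0 where "F0 \<in> U" by blast
  then obtain F where F: "F \<in> U" "C F" "cvs.dim (Stab F 1) \<le> ind TYPE('a)"
    using generic_meets_open[OF generic_conj[OF C generic_ind] U(1)] by blast
  have dual: "F \<in> dual" using F(1) U(1) by (meson openin_imp_subset subsetD)
  have prec: "one_precise F" using F(1) U(3) by blast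
  have dim: "cvs.dim (Stab F 1) = ind TYPE('a)"
    using F(3) ind_le_dim_Stab[OF dual] by simp
  have "split_functional F"
  proof
    show "F \<in> dual" by (rule dual)
    show "a * b = b * a" if "a \<in> Stab F 1" "b \<in> Stab F 1" for a b
      by (rule Stab_commutative_if_minimal[OF dual _ that]) (simp add: dim ind_le_dim_Stab)
    show "a = 0" if "a \<in> Stab F 1" "\<And>b. b \<in> Stab F 1 \<Longrightarrow> F (a * b) = 0" for a
      using one_precise_Stab_nondegenerate[OF dual prec that] .
  qed
  then show thesis using that prec F(2) dim by blast
qed

text \<open>A nonzero characteristic polynomial has finitely many roots. It suffices to find one nondegenerate
  member \<open>(p, q)\<close> of the pencil with \<open>p \<noteq> 0\<close>, as the others are then covered by
  \<open>pencil_injective_cofinite\<close>.\<close>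

lemma finite_degenerate_parameters:
  fixes G :: "'b::fd_complex_algebra \<Rightarrow> complex"
  assumes G: "G \<in> dual" and chi: "chi G \<noteq> 0"
  shows "finite {\<beta>. \<not> nondegenerate 1 (- \<beta>) G}"
proof -
  have form: "linear_form (pencil G p q)" for p q by (rule linear_form_pencil[OF G])
  obtain p q where pq: "nondegenerate p q G" "p \<noteq> 0"
  proof -
    obtain p q where pq: "nondegenerate p q G"
      by (rule nondegenerate_if_chi_nonzero[OF G chi])
    show thesis
    proof (cases "p = 0")
      case True
      have "finite {t. \<exists>x\<in>UNIV. x \<noteq> 0 \<and> (\<forall>y. pencil G 0 1 x y + t * pencil G 1 0 x y = 0)}"
      proof (rule pencil_injective_cofinite[OF form form cvs.subspace_UNIV])
        fix x assume "\<And>y. pencil G 0 1 x y + 0 * pencil G 1 0 x y = 0"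
        then have "\<forall>y. pencil G p q x y = 0" by (simp add: pencil_def True)
        then show "x = 0" using pq unfolding nondegenerate_def by blast
      qed
      then have "finite (insert 0 {t. \<exists>x\<in>UNIV. x \<noteq> 0 \<and> (\<forall>y. pencil G 0 1 x y + t * pencil G 1 0 x y = 0)})"
        by simp
      from ex_new_if_finite[OF infinite_UNIV_char_0 this]
      obtain t where t: "t \<noteq> 0" "\<And>x. x \<noteq> 0 \<Longrightarrow> \<exists>y. pencil G 0 1 x y + t * pencil G 1 0 x y \<noteq> 0" by auto
      have "nondegenerate t 1 G"
        unfolding nondegenerate_def
      proof (intro allI impI, rule ccontr)
        fix a assume "\<forall>x. pencil G t 1 a x = 0" "a \<noteq> 0"
        then show False using t(2)[of a] by (auto simp: pencil_def algebra_simps)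
      qed
      then show thesis using that t(1) by blast
    qed (use pq that in blast)
  qed
  have "finite {t. \<exists>x\<in>UNIV. x \<noteq> 0 \<and> (\<forall>y. pencil G 1 0 x y + t * pencil G 0 (-1) x y = 0)}"
  proof (rule pencil_injective_cofinite[OF form form cvs.subspace_UNIV, where r = "- q / p"])
    fix x assume x: "\<And>y. pencil G 1 0 x y + (- q / p) * pencil G 0 (-1) x y = 0"
    have "pencil G p q x y = p * (pencil G 1 0 x y + (- q / p) * pencil G 0 (-1) x y)" for y
      using pq(2) by (simp add: pencil_def field_simps)
    then have "\<forall>y. pencil G p q x y = 0" using x by simp
    then show "x = 0" using pq(1) unfolding nondegenerate_def by blast
  qed
  then show ?thesis
    by (rule finite_subset[rotated]) (auto simp: nondegenerate_def pencil_def)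
qed

text \<open>The pair \<open>(-\<beta>, 1)\<close> lies on the line of the root \<open>1/\<beta>\<close>, and \<open>(0, 1)\<close> on that of the root at infinity.
  Each point other than 1 fails to be a root for some functional, hence generically. Degeneracy at
  \<open>(1, 0)\<close> means that \<open>A\<^sub>F\<close> is singular and is covered by the root at infinity too.\<close>

lemma generic_nondegenerate_if_roots_vary:
  assumes vary: "nontrivial_roots_vary TYPE('a::fd_complex_algebra)"
  shows "\<beta> \<noteq> 1 \<Longrightarrow> generic (nondegenerate (- \<beta>) 1 :: ('a \<Rightarrow> complex) \<Rightarrow> bool)"
    and "generic (nondegenerate 1 0 :: ('a \<Rightarrow> complex) \<Rightarrow> bool)"
proof -
  have nonroot: "\<exists>F :: 'a \<Rightarrow> complex. F \<in> dual \<and> \<not> is_root \<alpha> (chi F)" if "\<alpha> \<noteq> Fin 1" for \<alpha>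
    using vary that unfolding nontrivial_roots_vary_def by blast
  show "generic (nondegenerate (- \<beta>) 1 :: ('a \<Rightarrow> complex) \<Rightarrow> bool)" if "\<beta> \<noteq> 1"
  proof -
    have "(if - \<beta> = 0 then Infty else Fin (- 1 / - \<beta>)) \<noteq> Fin 1"
      using that by (simp add: divide_eq_eq)
    from nonroot[OF this] obtain F :: "'a \<Rightarrow> complex" where F: "F \<in> dual"
      "\<not> is_root (if - \<beta> = 0 then Infty else Fin (- 1 / - \<beta>)) (chi F)"
      by blast
    have "nondegenerate (- \<beta>) 1 F"
      using is_root_if_degenerate[OF F(1), of "- \<beta>"] F(2) by blast
    then show ?thesis by (rule generic_nondegenerate[OF F(1)])
  qed
  obtain F :: "'a \<Rightarrow> complex" where F: "F \<in> dual" "\<not> is_root Infty (chi F)"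
    using nonroot[of Infty] by auto
  have "nondegenerate 1 0 F"
    using infinity_root_if_degenerate[OF F(1)] F(2) by blast
  then show "generic (nondegenerate 1 0 :: ('a \<Rightarrow> complex) \<Rightarrow> bool)"
    by (rule generic_nondegenerate[OF F(1)])
qed

theorem theorem32:
  assumes "type1_alg TYPE('a::fd_complex_algebra)"
    and "one_precise_alg TYPE('a)"
    and "type1_alg TYPE('b::fd_complex_algebra)"
    and "one_precise_alg TYPE('b)"
    and "nontrivial_roots_vary TYPE('a)"
  shows "ind TYPE(('a, 'b) tensor) = ind TYPE('a) * ind TYPE('b)"
proof -
  have "generic (\<lambda>_ :: 'b \<Rightarrow> complex. True)" using dual_zero_fun by (auto simp: generic_def)
  then obtain G :: "'b \<Rightarrow> complex" where G: "split_functional G" "one_precise G"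
    "cvs.dim (Stab G 1) = ind TYPE('b)"
    by (rule ex_split_functional[OF assms(4)]) blast
  \<comment> \<open>The parameters that \<open>F\<close> must avoid because of \<open>G\<close>; adding \<open>0\<close> makes the form of \<open>F\<close> nondegenerate on
    the other side as well.\<close>
  define R where "R = {\<beta>. \<not> nondegenerate 1 (- \<beta>) G} - {1}"
  have "finite R"
    using finite_degenerate_parameters[OF split_functional.F[OF G(1)] one_precise_chi_nonzero[OF G(2)]]
    by (simp add: R_def)
  note gen = generic_nondegenerate_if_roots_vary[OF assms(5)]
  have "generic (\<lambda>F :: 'a \<Rightarrow> complex. \<forall>\<beta>\<in>insert 0 R. nondegenerate (- \<beta>) 1 F)"
    using \<open>finite R\<close> by (intro generic_Ball gen(1)) (auto simp: R_def)
  note generic = generic_conj[OF gen(2) this]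
  obtain F :: "'a \<Rightarrow> complex" where F: "split_functional F" "cvs.dim (Stab F 1) = ind TYPE('a)"
    "nondegenerate 1 0 F" "\<forall>\<beta>\<in>insert 0 R. nondegenerate (- \<beta>) 1 F"
    by (rule ex_split_functional[OF assms(2) generic]) blast
  have disjoint: "\<forall>\<beta>. \<beta> \<noteq> 1 \<longrightarrow> nondegenerate (- \<beta>) 1 F \<or> nondegenerate 1 (- \<beta>) G"
    using F(4) unfolding R_def by blast
  have "nondegenerate 0 1 F" using F(4) by simp
  note FG = split_functional_tensor[OF F(1) G(1) F(3) this disjoint]
  interpret FG: split_functional "functional_tensor F G" by (rule FG(1))
  have "ind TYPE(('a, 'b) tensor) = cvs.dim (Stab (functional_tensor F G) 1)"
    by (rule ind_eq[OF FG.F FG.dim_Stab_minimal])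
  also have "\<dots> = ind TYPE('a) * ind TYPE('b)"
    by (simp only: FG(2) F(2) G(3))
  finally show ?thesis .
qed

end
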